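(* Let $G=(V,E)$ be a finite simple graph without isolated vertices, let $c_1\le\dots\le c_n$ be the min-max eigenvalues of the signless 1-Laplacian and $\lambda_1\le\dots\le\lambda_n$ the eigenvalues of the normalized Laplacian $\Delta_2=I-D^{-1}A$. Then for every $k=1,\dots,n$, $\frac{c_k^2}{2}\le 2-\lambda_{n-k+1}\le 2c_k$.
   Context: $V=\{1,\dots,n\}$, $A$ the adjacency matrix, $D=\mathrm{diag}(d_1,\dots,d_n)$ the degree matrix. $I^+(\vec x)=\sum_{\{i,j\}\in E}|x_i+x_j|$, $X=\{\vec x:\sum_i d_i|x_i|=1\}$, $c_k=\inf\{\sup_{\vec x\in A'}I^+(\vec x): A'\subseteq X\text{ compact}, A'=-A',\gamma(A')\ge k\}$, with $\gamma$ the Krasnoselskii genus (least $m$ admitting a continuous odd map $A'\to\mathbb{R}^m\setminus\{0\}$). *)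

theory Defs
  imports
    "HOL-Analysis.Analysis"
    "HOL-Computational_Algebra.Computational_Algebra"
    "HOL-Library.Extended_Nat"
begin

(* Graphs on the vertex set UNIV :: 'v set are given by their edge sets, so that n = CARD('v). *)

definition simple_graph :: "'v::finite set set \<Rightarrow> bool" where
  "simple_graph E \<longleftrightarrow> (\<forall>e\<in>E. card e = 2)"

definition vertex_degree :: "'v::finite set set \<Rightarrow> 'v \<Rightarrow> nat" where
  "vertex_degree E i = card {e \<in> E. i \<in> e}"

definition no_isolated_vertices :: "'v::finite set set \<Rightarrow> bool" where
  "no_isolated_vertices E \<longleftrightarrow> (\<forall>i. \<exists>e\<in>E. i \<in> e)"

definition adjacency_matrix :: "'v::finite set set \<Rightarrow> real ^ 'v ^ 'v" where
  "adjacency_matrix E = (\<chi> i j. if {i, j} \<in> E then 1 else 0)"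

definition degree_matrix :: "'v::finite set set \<Rightarrow> real ^ 'v ^ 'v" where
  "degree_matrix E = (\<chi> i j. if i = j then real (vertex_degree E i) else 0)"

definition normalized_laplacian :: "'v::finite set set \<Rightarrow> real ^ 'v ^ 'v" where
  "normalized_laplacian E = mat 1 - matrix_inv (degree_matrix E) ** adjacency_matrix E"

definition charpoly :: "real ^ 'v ^ 'v \<Rightarrow> real poly" where
  "charpoly M = det (\<chi> i j. (if i = j then [:0, 1:] else 0) - [:M $ i $ j:])"

(* The k-th smallest real eigenvalue, counted with algebraic multiplicity; k starts at 1.
   The normalized Laplacian is similar to a symmetric matrix, so it has CARD('v) real
   eigenvalues and the list access is in range for 1 <= k <= CARD('v). *)
definition eigenvalue :: "real ^ 'v ^ 'v \<Rightarrow> nat \<Rightarrow> real" where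
  "eigenvalue M k = sorted_list_of_multiset (proots (charpoly M)) ! (k - 1)"

(* For an edge e = {i, j} the summand is |x_i + x_j|. *)
definition I_plus :: "'v::finite set set \<Rightarrow> real ^ 'v \<Rightarrow> real" where
  "I_plus E x = (\<Sum>e\<in>E. \<bar>\<Sum>i\<in>e. x $ i\<bar>)"

definition unit_sphere_1 :: "'v::finite set set \<Rightarrow> (real ^ 'v) set" where
  "unit_sphere_1 E = {x. (\<Sum>i\<in>UNIV. real (vertex_degree E i) * \<bar>x $ i\<bar>) = 1}"

definition odd_map_on :: "'a::real_normed_vector set \<Rightarrow> ('a \<Rightarrow> nat \<Rightarrow> real) \<Rightarrow> bool" where
  "odd_map_on S f \<longleftrightarrow> (\<forall>x\<in>S. f (- x) = (\<lambda>i. - f x i))"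

(* The target R^m with the origin removed is a subspace of Euclidean_space m, because m has to
   be quantified. The infimum of a nonempty set in enat is its least element; the genus is
   infinity if there is no odd map for any m. *)
definition krasnoselskii_genus :: "'a::real_normed_vector set \<Rightarrow> enat" where
  "krasnoselskii_genus S =
     Inf {enat m | m. \<exists>f.
            continuous_map (top_of_set S) (subtopology (Euclidean_space m) (- {\<lambda>i. 0})) f \<and>
            odd_map_on S f}"

(* I_plus is bounded by 0 and 1 on unit_sphere_1, so for k >= 1 the suprema are over nonempty
   bounded sets and the infimum is over a set bounded below. For k <= CARD('v) that set contains
   the value of the whole sphere, whose genus is CARD('v). *)
definition minmax_eigenvalue :: "'v::finite set set \<Rightarrow> nat \<Rightarrow> real" where
  "minmax_eigenvalue E k =
     Inf {Sup (I_plus E ` S) | S.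
            S \<subseteq> unit_sphere_1 E \<and> compact S \<and> S = uminus ` S \<and> enat k \<le> krasnoselskii_genus S}"

end

theory Submission
  imports Defs "HOL-Homology.Homology"
begin

text \<open>
  Put \<open>D\<close> for the degree matrix and \<open>\<phi>(x)\<^sub>i = x\<^sub>i \<bar>x\<^sub>i\<bar>\<close>, an odd homeomorphism from the sphere \<open>\<Sum> d\<^sub>i x\<^sub>i\<^sup>2 = 1\<close> onto
  \<open>X\<close>. With \<open>Q(x) = \<Sum> (x\<^sub>i + x\<^sub>j)\<^sup>2\<close>, the sum ranging over the edges, elementary estimates on each edge and the
  Cauchy-Schwarz inequality give \<open>Q(x) / 2 \<le> I\<^sup>+(\<phi>(x)) \<le> sqrt (2 Q(x))\<close> on that sphere, where \<open>Q\<close> is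
  the quadratic form of \<open>2 - \<Delta>\<^sub>2\<close>. A set of genus at least \<open>k\<close> contains a point orthogonal to
  the eigenvectors of the \<open>k - 1\<close> largest eigenvalues of \<open>\<Delta>\<^sub>2\<close>, which yields the upper estimate. The image under \<open>\<phi>\<close> of
  the unit sphere of the eigenvectors of the \<open>k\<close> largest eigenvalues yields the lower one; by the Borsuk-Ulam
  theorem it has genus at least \<open>k\<close>.

  For Borsuk-Ulam, an odd self-map of the sphere has odd degree. This follows by induction on the
  dimension from the degree comparison modulo 2 of the library, which assumes that the map preserves the
  equator. To achieve this, replace the map by an odd polynomial approximation \<open>p\<close>. The cone
  over the image of the equator under \<open>p\<close> is a null set, so some vector \<open>a\<close> is not in it, and \<open>p\<close> can be
  deformed along \<open>a\<close>, without zeros, until the equator is mapped into itself.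
\<close>

section \<open>Odd maps of spheres\<close>

text \<open>The carrier of \<open>nsphere n\<close> as a plain set of functions
  \<open>nat => real\<close>, so that \<open>continuous_on\<close> and \<open>compact\<close> apply
  to it.\<close>

definition std_sphere :: "nat \<Rightarrow> (nat \<Rightarrow> real) set" where
  "std_sphere n = {x. (\<Sum>i\<le>n. (x i)\<^sup>2) = 1 \<and> (\<forall>i>n. x i = 0)}"

lemma nsphere_std_sphere: "nsphere n = top_of_set (std_sphere n)"
  unfolding nsphere std_sphere_def euclidean_product_topology by simp

lemma topspace_nsphere_std_sphere [simp]: "topspace (nsphere n) = std_sphere n"
  by (simp add: nsphere_std_sphere)

text \<open>The points live in an infinite product, so Tychonoff replaces Heine-Borel: the sphere is
  a closed subset of a product of compact intervals and singletons.\<close>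

lemma compact_std_sphere: "compact (std_sphere n)"
proof -
  have "compactin (powertop_real UNIV) (PiE UNIV (\<lambda>i. if i \<le> n then {-1..1} else {0}))"
    by (subst compactin_PiE) auto
  then have "compact (PiE UNIV (\<lambda>i::nat. if i \<le> n then {-1..1} else {0::real}))"
    by (simp add: euclidean_product_topology)
  moreover have "closed (std_sphere n)"
  proof -
    have "continuous_on UNIV (\<lambda>x::nat \<Rightarrow> real. \<Sum>i\<le>n. (x i)\<^sup>2)"
      by (intro continuous_intros continuous_on_product_coordinates)
    then have "closed {x::nat \<Rightarrow> real. (\<Sum>i\<le>n. (x i)\<^sup>2) = 1}"
      by (rule closed_Collect_eq) (rule continuous_on_const)
    moreover have "closed {x::nat \<Rightarrow> real. i > n \<longrightarrow> x i = 0}" for i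
      by (cases "i > n") (auto intro!: closed_Collect_eq)
    then have "closed {x::nat \<Rightarrow> real. \<forall>i>n. x i = 0}"
      by (rule closed_Collect_all)
    ultimately show ?thesis unfolding std_sphere_def Collect_conj_eq by (rule closed_Int)
  qed
  moreover have "x i \<in> (if i \<le> n then {-1..1} else {0})" if "x \<in> std_sphere n" for x i
  proof (cases "i \<le> n")
    case True
    then have "(x i)\<^sup>2 \<le> (\<Sum>i\<le>n. (x i)\<^sup>2)"
      by (intro member_le_sum) auto
    then have "\<bar>x i\<bar> \<le> 1" using that by (simp add: std_sphere_def abs_square_le_1)
    with True show ?thesis by auto
  qed (use that in \<open>auto simp: std_sphere_def\<close>)
  then have "std_sphere n \<subseteq> PiE UNIV (\<lambda>i. if i \<le> n then {-1..1} else {0})" by auto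
  ultimately show ?thesis
    by (metis compact_Int_closed inf.absorb2)
qed

lemma uminus_std_sphere: "x \<in> std_sphere n \<Longrightarrow> (\<lambda>i. - x i) \<in> std_sphere n"
  by (simp add: std_sphere_def)

lemma std_sphere_mono: "m \<le> n \<Longrightarrow> std_sphere m \<subseteq> std_sphere n"
proof
  fix x assume "m \<le> n" and x: "x \<in> std_sphere m"
  have "(\<Sum>i\<le>n. (x i)\<^sup>2) = (\<Sum>i\<le>m. (x i)\<^sup>2)"
    by (rule sum.mono_neutral_right) (use x \<open>m \<le> n\<close> in \<open>auto simp: std_sphere_def\<close>)
  with x \<open>m \<le> n\<close> show "x \<in> std_sphere n" by (auto simp: std_sphere_def)
qed

section \<open>Radial projection and normalised straight-line homotopies\<close>

definition radial_proj :: "nat \<Rightarrow> (nat \<Rightarrow> real) \<Rightarrow> nat \<Rightarrow> real" where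
  "radial_proj n y = (\<lambda>i. y i / sqrt (\<Sum>j\<le>n. (y j)\<^sup>2))"

lemma radial_proj_uminus: "radial_proj n (\<lambda>i. - y i) = (\<lambda>i. - radial_proj n y i)"
  by (simp add: radial_proj_def)

lemma radial_proj_in_std_sphere:
  assumes "\<And>i. i > n \<Longrightarrow> y i = 0" "\<exists>i\<le>n. y i \<noteq> 0"
  shows "radial_proj n y \<in> std_sphere n"
  using assms by (force simp: radial_proj_def std_sphere_def sum_nonneg sum_nonneg_eq_0_iff field_split_simps simp flip: sum_divide_distrib)

lemma continuous_on_radial_proj:
  assumes "continuous_on S g" "\<And>x. x \<in> S \<Longrightarrow> \<exists>i\<le>n. g x i \<noteq> 0"
  shows "continuous_on S (\<lambda>x. radial_proj n (g x))"
  unfolding radial_proj_def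
  apply (intro continuous_on_coordinatewise_then_product continuous_intros
         continuous_on_product_then_coordinatewise[OF assms(1)])
  using assms(2) by (auto simp: sum_nonneg_eq_0_iff)

lemma radial_proj_std_sphere: "x \<in> std_sphere n \<Longrightarrow> radial_proj n x = x"
  by (auto simp: radial_proj_def std_sphere_def)

text \<open>The segment from \<open>g x\<close> to \<open>h x\<close> misses the origin by
  \<open>nz\<close>, so normalising it gives a homotopy inside the sphere.\<close>

lemma homotopic_radial_proj:
  assumes g: "continuous_on (std_sphere n) g" and h: "continuous_on (std_sphere n) h"
    and g0: "\<And>x i. x \<in> std_sphere n \<Longrightarrow> i > n \<Longrightarrow> g x i = 0"
    and h0: "\<And>x i. x \<in> std_sphere n \<Longrightarrow> i > n \<Longrightarrow> h x i = 0"
    and nz: "\<And>x t. x \<in> std_sphere n \<Longrightarrow> 0 \<le> t \<Longrightarrow> t \<le> 1 \<Longrightarrow> \<exists>i\<le>n. (1 - t) * g x i + t * h x i \<noteq> 0"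
  shows "homotopic_with (\<lambda>_. True) (nsphere n) (nsphere n) (\<lambda>x. radial_proj n (g x)) (\<lambda>x. radial_proj n (h x))"
proof -
  define H where "H = (\<lambda>(t, x). radial_proj n (\<lambda>i. (1 - t) * g x i + t * h x i))"
  have "continuous_on ({0..1} \<times> std_sphere n) H"
    unfolding H_def case_prod_unfold
  proof (rule continuous_on_radial_proj)
    have "continuous_on ({0..1} \<times> std_sphere n) (\<lambda>z::real \<times> (nat \<Rightarrow> real). g (snd z) i)" for i
      by (rule continuous_on_compose2[OF continuous_on_product_then_coordinatewise[OF g]])
        (auto intro!: continuous_on_snd continuous_on_id)
    moreover have "continuous_on ({0..1} \<times> std_sphere n) (\<lambda>z::real \<times> (nat \<Rightarrow> real). h (snd z) i)" for i
      by (rule continuous_on_compose2[OF continuous_on_product_then_coordinatewise[OF h]])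
        (auto intro!: continuous_on_snd continuous_on_id)
    ultimately show "continuous_on ({0..1} \<times> std_sphere n)
        (\<lambda>z i. (1 - fst z) * g (snd z) i + fst z * h (snd z) i)"
      by (intro continuous_on_coordinatewise_then_product continuous_intros)
  qed (use nz in auto)
  moreover have "H z \<in> std_sphere n" if "z \<in> {0..1} \<times> std_sphere n" for z
    unfolding H_def case_prod_unfold
    by (rule radial_proj_in_std_sphere) (use that g0 h0 nz in auto)
  ultimately have "continuous_map (prod_topology (top_of_set {0..1}) (nsphere n)) (nsphere n) H"
    by (auto simp: nsphere_std_sphere prod_topology_subtopology_eu image_subset_iff)
  then show ?thesis
    unfolding homotopic_with_def
    by (intro exI[of _ H]) (auto simp: H_def)
qed

section \<open>Avoiding the cone over the image of the equator\<close>

lemma exists_basis_enum: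
  obtains b :: "nat \<Rightarrow> 'a::euclidean_space"
  where "bij_betw b {..<DIM('a)} Basis"
  using ex_bij_betw_nat_finite[OF finite_Basis] by (metis atLeast0LessThan)

lemma inner_basis_enum:
  fixes b :: "nat \<Rightarrow> 'a::euclidean_space"
  assumes b: "bij_betw b {..<DIM('a)} Basis" and ij: "i < DIM('a)" "j < DIM('a)"
  shows "b i \<bullet> b j = (if i = j then 1 else 0)"
proof -
  have "b i \<in> Basis" "b j \<in> Basis" using b ij by (auto simp: bij_betw_def)
  moreover have "b i = b j \<longleftrightarrow> i = j" using b ij by (auto simp: bij_betw_def inj_on_def)
  ultimately show ?thesis by (simp add: inner_Basis)
qed

text \<open>The lines through the origin and the points \<open>p x\<close>, for \<open>x\<close> on
  the equator, form a set of dimension at most \<open>n\<close> in an (n+1)-dimensional space, so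
  almost every \<open>a\<close> lies on none of them. The equator \<open>x n = 0\<close> is embedded
  in \<open>'a\<close> to use Lebesgue null sets; the coordinates above \<open>n\<close> are
  padding.\<close>

lemma odd_map_avoid:
  fixes p :: "'a::euclidean_space \<Rightarrow> 'a" and b :: "nat \<Rightarrow> 'a"
  assumes b: "bij_betw b {..<DIM('a)} Basis" and n: "n < DIM('a)"
    and diff: "\<And>z. p differentiable (at z)"
    and odd: "\<And>z. p (- z) = - p z"
  obtains a where "a n \<noteq> (0::real)"
    "\<And>x t. x \<in> std_sphere n \<Longrightarrow> x n = 0 \<Longrightarrow> \<exists>i\<le>n. t * (p (\<Sum>j\<le>n. x j *\<^sub>R b j) \<bullet> b i) \<noteq> a i"
proof -
  let ?D = "DIM('a)"
  have bB: "b i \<in> Basis" if "i < ?D" for i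
    using b that by (auto simp: bij_betw_def)
  note bb = inner_basis_enum[OF b]
  have inner_sum: "(\<Sum>j\<in>J. f j *\<^sub>R b j) \<bullet> b i = (if i \<in> J then f i else 0)" 
    if "J \<subseteq> {..<?D}" "i < ?D" for J f i
  proof -
    have fJ: "finite J" using that finite_subset by auto
    have "(\<Sum>j\<in>J. f j *\<^sub>R b j) \<bullet> b i = (\<Sum>j\<in>J. f j * (b j \<bullet> b i))"
      by (simp add: inner_sum_left)
    also have "\<dots> = (\<Sum>j\<in>J. if j = i then f j else 0)"
      by (rule sum.cong) (use that bb in auto)
    finally show ?thesis using fJ by simp
  qed
  \<comment> \<open>\<open>w\<close> is the projection to the first \<open>n\<close> coordinates.
    \<open>F\<close> extends \<open>p\<close> from the equator by positive homogeneity of degree 1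
    and is the identity in the coordinates above \<open>n\<close>, so it maps \<open>'a\<close> to
    \<open>'a\<close>.\<close>
  define w where "w z = (\<Sum>i<n. (z \<bullet> b i) *\<^sub>R b i)" for z
  define F where "F z = (\<Sum>i\<le>n. (norm (w z) * (p (w z /\<^sub>R norm (w z)) \<bullet> b i)) *\<^sub>R b i)
                      + (\<Sum>i\<in>{n<..<?D}. (z \<bullet> b i) *\<^sub>R b i)" for z
  \<comment> \<open>\<open>H\<close> lies in a hyperplane, hence is null; points with
    \<open>w z = 0\<close> are left out because the norm is not differentiable there.\<close>
  define H where "H = {z. z \<bullet> b n = 0 \<and> w z \<noteq> 0}"
  have "negligible H"
    by (rule negligible_subset[OF negligible_standard_hyperplane[OF bB[OF n], of 0]]) (auto simp: H_def)
  moreover have "F differentiable_on H"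
    unfolding differentiable_on_def
  proof
    fix z assume z: "z \<in> H"
    have dw: "w differentiable (at z within H)"
      unfolding w_def by (intro derivative_intros differentiable_sum) auto
    have dn: "(\<lambda>z. norm (w z)) differentiable (at z within H)"
      using z by (intro differentiable_compose[OF _ dw] differentiable_norm_at) (auto simp: H_def)
    have du: "(\<lambda>z. w z /\<^sub>R norm (w z)) differentiable (at z within H)"
      using z by (intro differentiable_scaleR differentiable_inverse dn dw) (auto simp: H_def)
    have di: "(\<lambda>v::'a. v \<bullet> c) differentiable (at v)" for c v
      by (intro bounded_linear_imp_differentiable bounded_linear_inner_left)
    have dp: "(\<lambda>z. p (w z /\<^sub>R norm (w z)) \<bullet> b i) differentiable (at z within H)" for i
      by (intro differentiable_compose[OF di] differentiable_compose[OF diff] du)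
    show "F differentiable (at z within H)"
      unfolding F_def
      by (intro differentiable_add differentiable_sum differentiable_scaleR differentiable_mult dn dp
           differentiable_const finite_atMost finite_greaterThanLessThan
           bounded_linear_imp_differentiable bounded_linear_inner_left ballI)
  qed
  ultimately have "negligible (F ` H)"
    by (intro negligible_differentiable_image_negligible) auto
  \<comment> \<open>The hyperplane is thrown in to obtain \<open>a\<close> with nonzero coordinate
    \<open>n\<close> as well.\<close>
  then have "negligible (F ` H \<union> {z. z \<bullet> b n = 0})"
    using negligible_standard_hyperplane[OF bB[OF n], of 0] negligible_Un by blast
  then obtain a where a: "a \<notin> F ` H" "a \<bullet> b n \<noteq> 0"
    using non_negligible_UNIV by (metis (mono_tags, lifting) UNIV_eq_I Un_iff mem_Collect_eq)
  have False if x: "x \<in> std_sphere n" "x n = 0" and t: "\<And>i. i \<le> n \<Longrightarrow> t * (p (\<Sum>j\<le>n. x j *\<^sub>R b j) \<bullet> b i) = a \<bullet> b i" and "t > 0" for x t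
  proof -
    define y where "y = (\<Sum>j\<le>n. x j *\<^sub>R b j)"
    \<comment> \<open>Chosen so that \<open>w z = t y\<close> with \<open>norm y = 1\<close> and the
      upper coordinates agree with those of \<open>a\<close>; then \<open>z\<close> is in
      \<open>H\<close> and \<open>F z = a\<close>.\<close>
    define z where "z = t *\<^sub>R y + (\<Sum>i\<in>{n<..<?D}. (a \<bullet> b i) *\<^sub>R b i)"
    have zi: "z \<bullet> b i = (if i \<le> n then t * x i else a \<bullet> b i)" if "i < ?D" for i
      using that n unfolding z_def y_def
      by (simp add: inner_add_left inner_sum atMost_def subset_eq)
    have y': "y = (\<Sum>j<n. x j *\<^sub>R b j)"
      unfolding y_def using x(2) by (simp add: lessThan_Suc_atMost[symmetric])
    have wz: "w z = t *\<^sub>R y"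
      unfolding w_def y' scaleR_sum_right using n by (intro sum.cong) (auto simp: zi)
    have "y \<bullet> y = (\<Sum>i\<le>n. x i * (y \<bullet> b i))"
      by (subst (2) y_def) (simp add: inner_sum_right)
    also have "\<dots> = (\<Sum>i\<le>n. (x i)\<^sup>2)"
      using n by (intro sum.cong) (auto simp: y_def inner_sum power2_eq_square subset_eq)
    finally have ny: "norm y = 1" using x by (simp add: std_sphere_def norm_eq_sqrt_inner)
    have nw: "norm (w z) = t" using ny \<open>t > 0\<close> by (simp add: wz)
    have wn: "w z /\<^sub>R norm (w z) = y" using \<open>t > 0\<close> by (simp add: nw) (simp add: wz)
    have "z \<in> H" unfolding H_def using zi[OF n] x nw \<open>t > 0\<close> by auto
    moreover have "F z = a"
    proof (rule euclidean_eqI)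
      fix c :: 'a assume "c \<in> Basis"
      then obtain i where i: "i < ?D" "c = b i" using b by (auto simp: bij_betw_def)
      show "F z \<bullet> c = a \<bullet> c"
        unfolding F_def wn unfolding nw using i n t[folded y_def]
        by (auto simp: inner_add_left inner_sum subset_eq zi)
    qed
    ultimately show False using a by auto
  qed
  note pos = this
  show ?thesis
  proof
    show "a \<bullet> b n \<noteq> 0" by fact
    fix x t assume x: "x \<in> std_sphere n" "x n = 0"
    show "\<exists>i\<le>n. t * (p (\<Sum>j\<le>n. x j *\<^sub>R b j) \<bullet> b i) \<noteq> a \<bullet> b i"
    proof (rule ccontr)
      assume "\<not> ?thesis"
      then have t: "\<And>i. i \<le> n \<Longrightarrow> t * (p (\<Sum>j\<le>n. x j *\<^sub>R b j) \<bullet> b i) = a \<bullet> b i" by auto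
      consider "t = 0" | "t > 0" | "t < 0" by linarith
      then show False
      proof cases
        case 1 then show False using t[of n] a by simp
      next
        case 2 then show False using pos x t by blast
      next
        \<comment> \<open>Oddness of \<open>p\<close> turns a negative multiple at \<open>x\<close>
          into a positive multiple at the antipode.\<close>
        case 3
        show False
          by (rule pos[of "\<lambda>i. - x i" "- t"]) 
            (use 3 x t in \<open>auto simp: uminus_std_sphere sum_negf odd\<close>)
      qed
    qed
  qed
qed

text \<open>The type \<open>'a\<close> supplies one fixed Euclidean space of dimension above
  \<open>n\<close>, in which polynomial approximation and null sets are available; the induction on
  \<open>n\<close> never changes it.\<close>

theorem Borsuk_odd_mapping_degree:
  assumes n: "n < DIM('a::euclidean_space)"
    and f: "continuous_map (nsphere n) (nsphere n) f"
    and odd: "\<And>x. x \<in> std_sphere n \<Longrightarrow> f (\<lambda>i. - x i) = (\<lambda>i. - f x i)"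
  shows "odd (Brouwer_degree2 n f)"
  using assms
proof (induction n arbitrary: f)
  case 0
  \<comment> \<open>The 0-sphere has two points, so an odd self-map is the identity or the
    reflection, of degree 1 or -1.\<close>
  have S0: "x = (\<lambda>i. if i = 0 then 1 else 0) \<or> x = (\<lambda>i. if i = 0 then -1 else 0)" if "x \<in> std_sphere 0" for x
    using that by (auto simp: std_sphere_def power2_eq_1_iff fun_eq_iff)
  let ?e = "\<lambda>i::nat. if i = 0 then 1 else 0 :: real"
  have e: "?e \<in> std_sphere 0" by (simp add: std_sphere_def)
  have fe: "f ?e \<in> std_sphere 0" using e 0(2) by (auto simp: nsphere_std_sphere)
  have ne: "(\<lambda>i::nat. if i = 0 then -1 else 0 :: real) = (\<lambda>i. - ?e i)" by auto
  from S0[OF fe] show ?case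
  proof
    assume "f ?e = ?e"
    then have "f x = id x" if "x \<in> std_sphere 0" for x
      using S0[OF that] 0(3)[OF e] by (auto simp: ne)
    then have "Brouwer_degree2 0 f = Brouwer_degree2 0 id"
      by (intro Brouwer_degree2_eq) simp
    then show ?thesis by simp
  next
    assume fm: "f ?e = (\<lambda>i. if i = 0 then -1 else 0)"
    let ?r = "\<lambda>x i. if i = 0 then -x i else x i"
    have "f x = ?r x" if "x \<in> std_sphere 0" for x
    proof -
      have "f x = (\<lambda>i. - x i)" using S0[OF that] 0(3)[OF e] fm by (auto simp: ne)
      then show ?thesis using that by (auto simp: std_sphere_def fun_eq_iff)
    qed
    then have "Brouwer_degree2 0 f = Brouwer_degree2 0 ?r"
      by (intro Brouwer_degree2_eq) simp
    then show ?thesis by (simp add: Brouwer_degree2_reflection)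
  qed
next
  case (Suc m)
  define n where "n = Suc m"
  note n = Suc.prems(1)[folded n_def] and f = Suc.prems(2)[folded n_def]
    and odd = Suc.prems(3)[folded n_def]
  obtain b :: "nat \<Rightarrow> 'a" where b: "bij_betw b {..<DIM('a)} Basis"
    by (rule exists_basis_enum)
  note bb = inner_basis_enum[OF b]
  \<comment> \<open>\<open>e\<close> embeds the sphere isometrically into \<open>'a\<close>;
    \<open>e'\<close> reads the coordinates up to \<open>n\<close> back.\<close>
  define e where "e x = (\<Sum>j\<le>n. x j *\<^sub>R b j)" for x
  define e' where "e' z = (\<lambda>i. if i \<le> n then z \<bullet> b i else 0)" for z
  have e_inner: "e x \<bullet> b i = x i" if "i \<le> n" for x i
  proof -
    have "e x \<bullet> b i = (\<Sum>j\<le>n. if j = i then x j else 0)"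
      unfolding e_def inner_sum_left using that n bb by (intro sum.cong) auto
    then show ?thesis using that by simp
  qed
  have e'e: "e' (e x) = x" if "x \<in> std_sphere n" for x
    using that by (auto simp: e'_def e_inner std_sphere_def fun_eq_iff)
  have fS: "f x \<in> std_sphere n" if "x \<in> std_sphere n" for x
    using f that by (auto simp: nsphere_std_sphere)
  have fc: "continuous_on (std_sphere n) f"
    using f by (simp add: nsphere_std_sphere)
  have e_neg: "e (\<lambda>i. - x i) = - e x" for x
    by (simp add: e_def sum_negf)
  have ec: "continuous_on S e" for S
    unfolding e_def
    by (intro continuous_intros continuous_on_subset[OF continuous_on_product_coordinates]) auto
  have e'c: "continuous_on S e'" for S
    unfolding e'_def
  proof (rule continuous_on_coordinatewise_then_product)
    fix i show "continuous_on S (\<lambda>z. if i \<le> n then z \<bullet> b i else 0)"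
      by (cases "i \<le> n") (auto intro!: continuous_intros)
  qed
  have "continuous_on (e ` std_sphere n) (\<lambda>z. e (f (e' z)))"
    by (rule continuous_on_compose2[OF ec continuous_on_compose2[OF fc e'c]]) (auto simp: e'e)
  \<comment> \<open>Error below 1 suffices, because the values \<open>e (f x)\<close> have norm
    1.\<close>
  then obtain g where g: "polynomial_function g"
    and gf: "\<And>z. z \<in> e ` std_sphere n \<Longrightarrow> norm (e (f (e' z)) - g z) < 1"
    using Stone_Weierstrass_polynomial_function[of "e ` std_sphere n" _ 1]
      compact_continuous_image[OF ec compact_std_sphere] by (metis zero_less_one)
  \<comment> \<open>The odd part of \<open>g\<close>. Since \<open>f\<close> is odd, averaging the
    errors at \<open>x\<close> and at its antipode shows that \<open>p\<close> is as good an
    approximation as \<open>g\<close>.\<close>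
  define p where "p z = (1/2) *\<^sub>R (g z - g (- z))" for z
  have p_odd: "p (- z) = - p z" for z by (simp add: p_def algebra_simps)
  have "p differentiable (at z)" for z
  proof -
    have "(\<lambda>z. g (- z)) differentiable (at z)"
      by (rule differentiable_compose[of g])
        (auto intro!: differentiable_at_polynomial_function[OF g] derivative_intros)
    then show ?thesis unfolding p_def 
      by (intro differentiable_scaleR differentiable_diff differentiable_const
           differentiable_at_polynomial_function[OF g])
  qed
  then obtain a where an: "a n \<noteq> (0::real)"
    and a: "\<And>x t. x \<in> std_sphere n \<Longrightarrow> x n = 0 \<Longrightarrow> \<exists>i\<le>n. t * (p (e x) \<bullet> b i) \<noteq> a i"
    using odd_map_avoid[of b n p, OF b n _ p_odd] unfolding e_def by blast
  have pf: "norm (e (f x) - p (e x)) < 1" if x: "x \<in> std_sphere n" for x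
  proof -
    have x': "(\<lambda>i. - x i) \<in> std_sphere n" using x by (rule uminus_std_sphere)
    have 1: "norm (e (f x) - g (e x)) < 1" using gf[of "e x"] x by (auto simp: e'e)
    have em: "e' (- e x) = (\<lambda>i. - x i)" using e'e[OF x'] by (simp only: e_neg)
    have 2: "norm (- e (f x) - g (- e x)) < 1"
      using gf[OF imageI[OF x']] by (simp only: e_neg em odd[OF x])
    have "e (f x) - p (e x) = (1/2) *\<^sub>R ((e (f x) - g (e x)) - (- e (f x) - g (- e x)))"
      by (simp add: p_def algebra_simps flip: scaleR_add_left)
    then have "norm (e (f x) - p (e x)) \<le> (norm (e (f x) - g (e x)) + norm (- e (f x) - g (- e x))) / 2"
      using norm_triangle_ineq4[of "e (f x) - g (e x)" "- e (f x) - g (- e x)"] by simp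
    also have "\<dots> < 1" using 1 2 by simp
    finally show ?thesis .
  qed
  define q where "q x = e' (p (e x))" for x
  have qi: "q x i = p (e x) \<bullet> b i" if "i \<le> n" for x i using that by (simp add: q_def e'_def)
  have q0: "q x i = 0" if "i > n" for x i using that by (simp add: q_def e'_def)
  have q_neg: "q (\<lambda>i. - x i) = (\<lambda>i. - q x i)" for x
    by (auto simp: q_def e'_def e_neg p_odd)
  have pc: "continuous_on UNIV p"
    using \<open>\<And>z. p differentiable (at z)\<close>
    by (auto intro!: differentiable_imp_continuous_on simp: differentiable_on_def)
  have qc: "continuous_on S q" for S
    unfolding q_def by (rule continuous_on_compose2[OF e'c continuous_on_compose2[OF pc ec]]) auto
  \<comment> \<open>At a zero of the segment, \<open>f x = t (f x - q x)\<close> up to coordinate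
    \<open>n\<close>, which has norm below 1 although \<open>f x\<close> has norm 1.\<close>
  have fq: "\<exists>i\<le>n. (1 - t) * f x i + t * q x i \<noteq> 0" if x: "x \<in> std_sphere n" and t: "0 \<le> t" "t \<le> 1" for x t
  proof (rule ccontr)
    assume "\<not> ?thesis"
    then have z: "f x i = t * (f x i - q x i)" if "i \<le> n" for i
      using that by (force simp: algebra_simps)
    define v where "v = e (f x) - p (e x)"
    have vi: "v \<bullet> b i = f x i - q x i" if "i \<le> n" for i
      using that by (simp add: v_def inner_diff_left e_inner qi)
    have "1 = (\<Sum>i\<le>n. (f x i)\<^sup>2)" using fS[OF x] by (simp add: std_sphere_def)
    also have "\<dots> = (\<Sum>i\<le>n. t\<^sup>2 * (v \<bullet> b i)\<^sup>2)"
      by (intro sum.cong refl, subst z) (auto simp: vi power_mult_distrib)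
    also have "\<dots> \<le> (\<Sum>i\<le>n. 1 * (v \<bullet> b i)\<^sup>2)"
      using t by (intro sum_mono mult_right_mono) (auto simp: power_le_one)
    also have "\<dots> \<le> (\<Sum>i<DIM('a). (v \<bullet> b i)\<^sup>2)"
      using n by simp (intro sum_mono2; auto)
    also have "\<dots> = v \<bullet> v"
      by (subst sum.reindex_bij_betw[OF b, of "\<lambda>c. (v \<bullet> c)\<^sup>2"])
        (simp add: euclidean_inner[of v v] power2_eq_square)
    also have "\<dots> < 1"
      using pf[OF x] by (simp add: v_def flip: power2_norm_eq_inner) (simp add: abs_square_less_1)
    finally show False by simp
  qed
  \<comment> \<open>On the equator the subtracted multiple of \<open>a\<close> cancels coordinate
    \<open>n\<close>. The weight \<open>1 - \<bar>x n\<bar>\<close> is even, which keeps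
    \<open>f'\<close> odd, and it is below 1 off the equator, which keeps the deformation free of
    zeros there.\<close>
  define f' where "f' x = (\<lambda>i. if i \<le> n then q x i - (1 - \<bar>x n\<bar>) * (q x n / a n) * a i else 0)" for x
  have f'_neg: "f' (\<lambda>i. - x i) = (\<lambda>i. - f' x i)" for x
    by (auto simp: f'_def q_neg algebra_simps)
  have xc: "continuous_on S (\<lambda>x. x i)" for S :: "(nat \<Rightarrow> real) set" and i
    by (intro continuous_on_subset[OF continuous_on_product_coordinates]) auto
  have f'c: "continuous_on S f'" for S
    unfolding f'_def
  proof (rule continuous_on_coordinatewise_then_product)
    fix i
    show "continuous_on S (\<lambda>x. if i \<le> n then q x i - (1 - \<bar>x n\<bar>) * (q x n / a n) * a i else 0)"
      by (cases "i \<le> n")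
       (use an in \<open>auto intro!: continuous_intros xc continuous_on_product_then_coordinatewise[OF qc]\<close>)
  qed
  have qf': "\<exists>i\<le>n. (1 - t) * q x i + t * f' x i \<noteq> 0" if x: "x \<in> std_sphere n" and t: "0 \<le> t" "t \<le> 1" for x t
  proof (rule ccontr)
    assume no: "\<not> ?thesis"
    \<comment> \<open>A zero of the deformation makes \<open>q x\<close> a multiple of
      \<open>a\<close>. Comparing coordinate \<open>n\<close> forces the weight and \<open>t\<close>
      to be 1, so \<open>x\<close> is on the equator, where the choice of \<open>a\<close> excludes
      this.\<close>
    have z: "q x i = t * (1 - \<bar>x n\<bar>) * (q x n / a n) * a i" if "i \<le> n" for i
    proof -
      have "(1 - t) * q x i + t * f' x i = 0" using no that by blast
      moreover have "f' x i = q x i - (1 - \<bar>x n\<bar>) * (q x n / a n) * a i"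
        using that by (simp add: f'_def)
      ultimately show ?thesis by (simp only:) (simp only: algebra_simps; linarith)
    qed
    have "q x n \<noteq> 0"
    proof
      assume "q x n = 0"
      then have "q x i = 0" if "i \<le> n" for i by (subst z[OF that]) simp
      then show False using fq[OF x, of 1] by auto
    qed
    moreover have "t * (1 - \<bar>x n\<bar>) * q x n = q x n" using z[of n] an by (metis order_refl nonzero_divide_eq_eq times_divide_eq_left times_divide_eq_right)
    ultimately have s: "t * (1 - \<bar>x n\<bar>) = 1" by simp
    have "(x n)\<^sup>2 \<le> (\<Sum>i\<le>n. (x i)\<^sup>2)"
      by (rule member_le_sum) auto
    then have "\<bar>x n\<bar> \<le> 1" using x by (simp add: std_sphere_def abs_square_le_1)
    then have "t * (1 - \<bar>x n\<bar>) \<le> 1 * (1 - \<bar>x n\<bar>)" using t by (intro mult_right_mono) auto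
    with s have xn: "x n = 0" by simp
    have "(a n / q x n) * (p (e x) \<bullet> b i) = a i" if "i \<le> n" for i
      unfolding qi[OF that, symmetric]
      by (subst z[OF that]) (use s \<open>q x n \<noteq> 0\<close> an in simp)
    with a[OF x xn, of "a n / q x n"] show False by auto
  qed
  have "homotopic_with (\<lambda>_. True) (nsphere n) (nsphere n) (\<lambda>x. radial_proj n (f x)) (\<lambda>x. radial_proj n (q x))"
    by (rule homotopic_radial_proj[OF fc qc]) (use fq fS q0 in \<open>auto simp: std_sphere_def\<close>)
  moreover have "homotopic_with (\<lambda>_. True) (nsphere n) (nsphere n) (\<lambda>x. radial_proj n (q x)) (\<lambda>x. radial_proj n (f' x))"
    by (rule homotopic_radial_proj[OF qc f'c]) (use qf' q0 in \<open>auto simp: f'_def\<close>)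
  ultimately have hom: "homotopic_with (\<lambda>_. True) (nsphere n) (nsphere n) (\<lambda>x. radial_proj n (f x)) (\<lambda>x. radial_proj n (f' x))"
    by (rule homotopic_with_trans)
  define h where "h x = radial_proj n (f' x)" for x
  have "Brouwer_degree2 n f = Brouwer_degree2 n (\<lambda>x. radial_proj n (f x))"
    by (rule Brouwer_degree2_eq) (use fS radial_proj_std_sphere in auto)
  also have "\<dots> = Brouwer_degree2 n h"
    unfolding h_def by (rule Brouwer_degree2_homotopic[OF hom])
  finally have deg: "Brouwer_degree2 n f = Brouwer_degree2 n h" .
  have hc: "continuous_map (nsphere n) (nsphere n) h"
    using homotopic_with_imp_continuous_maps[OF hom] by (simp add: h_def[abs_def])
  have h_neg: "h (\<lambda>i. - x i) = (\<lambda>i. - h x i)" for x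
    by (simp add: h_def f'_neg radial_proj_uminus)
  have hm: "h x \<in> std_sphere m" if "x \<in> std_sphere m" for x
  proof -
    have x: "x \<in> std_sphere n" "x n = 0" using that std_sphere_mono[of m n] by (auto simp: n_def std_sphere_def)
    have "h x \<in> std_sphere n" using hc x by (auto simp: nsphere_std_sphere)
    moreover have "h x n = 0" using an x by (simp add: h_def radial_proj_def f'_def)
    ultimately show ?thesis using topspace_nsphere_minus1[of "h x" n] by (simp add: n_def)
  qed
  \<comment> \<open>Now that \<open>h\<close> preserves the equator, its degree has the same parity
    as the degree of its restriction there.\<close>
  have "even (Brouwer_degree2 n h - Brouwer_degree2 (n - Suc 0) h)"
    by (rule Borsuk_odd_mapping_degree_step[OF hc]) (use h_neg hm in \<open>auto simp: n_def\<close>)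
  moreover have "odd (Brouwer_degree2 m h)"
  proof (rule Suc.IH)
    show "continuous_map (nsphere m) (nsphere m) h"
      using hc hm std_sphere_mono[of m n] by (auto simp: nsphere_std_sphere n_def intro: continuous_on_subset)
  qed (use n h_neg in \<open>auto simp: n_def\<close>)
  ultimately show ?case using deg by (simp add: n_def)
qed

section \<open>Eigenvalues of diagonalizable matrices\<close>

text \<open>A maximiser \<open>v\<close> of the Rayleigh quotient on the unit sphere of
  \<open>S\<close> is an eigenvector: the residual \<open>r\<close> lies in \<open>S\<close>, and a
  nonzero \<open>r\<close> would be a direction in which the quotient increases.\<close>

lemma selfadjoint_eigenvector:
  fixes f :: "'a::euclidean_space \<Rightarrow> 'a"
  assumes f: "linear f" and sa: "\<And>x y. f x \<bullet> y = x \<bullet> f y"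
    and S: "subspace S" "f ` S \<subseteq> S" "S \<noteq> {0}"
  obtains v c where "v \<in> S" "norm v = 1" "f v = c *\<^sub>R v"
proof -
  interpret f: linear f by fact
  define K where "K = S \<inter> sphere 0 1"
  have "compact K" unfolding K_def
    using closed_subspace[OF S(1)] by (intro closed_Int_compact) auto
  moreover obtain w where w: "w \<in> S" "w \<noteq> 0" using S subspace_0 by blast
  then have "w /\<^sub>R norm w \<in> K" using S(1) by (auto simp: K_def subspace_scale)
  moreover have "continuous_on K (\<lambda>x. x \<bullet> f x)"
    by (intro continuous_intros linear_continuous_on linear_linear[THEN iffD2] f)
  ultimately obtain v where v: "v \<in> K" and max: "\<And>x. x \<in> K \<Longrightarrow> x \<bullet> f x \<le> v \<bullet> f v"
    using continuous_attains_sup[of K] by (metis empty_iff)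
  define c where "c = v \<bullet> f v"
  have nv: "v \<bullet> v = 1" and vS: "v \<in> S" using v by (auto simp: K_def norm_eq_1)
  define g where "g x = c * (x \<bullet> x) - x \<bullet> f x" for x
  have g_pos: "g x \<ge> 0" if "x \<in> S" for x
  proof (cases "x = 0")
    case False
    then have "x /\<^sub>R norm x \<in> K" using that S(1) by (auto simp: K_def subspace_scale)
    from max[OF this] have "(x \<bullet> f x) / (norm x)\<^sup>2 \<le> c"
      by (simp add: f.scaleR c_def power2_eq_square divide_inverse mult_ac)
    then show ?thesis using False by (simp add: g_def field_simps power2_norm_eq_inner)
  qed (simp add: g_def f.zero)
  define r where "r = c *\<^sub>R v - f v"
  have rS: "r \<in> S" using S vS by (auto simp: r_def subspace_diff subspace_scale)
  \<comment> \<open>\<open>g\<close> is a nonnegative quadratic form vanishing at \<open>v\<close>, so its polar form with \<open>v\<close> vanishes.\<close>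
  have "0 \<le> g (v + t *\<^sub>R r)" for t
    using g_pos S(1) vS rS by (simp add: subspace_add subspace_scale)
  moreover have gt: "g (v + t *\<^sub>R r) = 2 * t * (r \<bullet> r) + t\<^sup>2 * g r" for t
  proof -
    have "f r \<bullet> v = r \<bullet> f v" by (rule sa)
    moreover have "r \<bullet> r = c * (v \<bullet> r) - r \<bullet> f v"
      by (subst (2) r_def) (simp add: inner_diff_right inner_commute)
    moreover from this have "t * (r \<bullet> r) = t * (c * (v \<bullet> r) - r \<bullet> f v)" by simp
    ultimately show ?thesis
      using nv by (simp add: g_def f.add f.scaleR inner_add_left inner_add_right c_def[symmetric]
          inner_commute algebra_simps power2_eq_square)
  qed
  ultimately have pos: "0 \<le> 2 * t * (r \<bullet> r) + t\<^sup>2 * g r" for t by simp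
  have "r \<bullet> r = 0"
  proof (rule ccontr)
    assume "r \<bullet> r \<noteq> 0"
    then have rr: "r \<bullet> r > 0" by simp
    have gr: "g r \<ge> 0" using g_pos rS by blast
    \<comment> \<open>Makes the linear term outweigh the quadratic one; adding 1 keeps the
      denominator positive when \<open>g r = 0\<close>.\<close>
    define t where "t = - (r \<bullet> r) / (g r + 1)"
    have td: "t * (g r + 1) = - (r \<bullet> r)" using gr by (simp add: t_def)
    have "(2 * t * (r \<bullet> r) + t\<^sup>2 * g r) * (g r + 1)\<^sup>2
        = 2 * (t * (g r + 1)) * (r \<bullet> r) * (g r + 1) + (t * (g r + 1))\<^sup>2 * g r"
      by (simp add: power2_eq_square algebra_simps)
    also have "\<dots> = - ((r \<bullet> r)\<^sup>2 * (g r + 2))"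
      unfolding td by (simp add: power2_eq_square algebra_simps)
    also have "\<dots> < 0" using gr rr by simp
    finally show False using pos[of t] gr by (simp add: mult_less_0_iff not_le)
  qed
  then have "f v = c *\<^sub>R v" by (simp add: r_def)
  then show ?thesis using that vS nv by (auto simp: norm_eq_1)
qed

text \<open>Split off one eigenvector and pass to its orthogonal complement in \<open>S\<close>,
  which self-adjointness keeps invariant; hence the statement for all invariant subspaces.\<close>

lemma selfadjoint_eigenbasis:
  fixes f :: "'a::euclidean_space \<Rightarrow> 'a"
  assumes f: "linear f" and sa: "\<And>x y. f x \<bullet> y = x \<bullet> f y"
    and S: "subspace S" "f ` S \<subseteq> S"
  shows "\<exists>B. B \<subseteq> S \<and> pairwise orthogonal B \<and> (\<forall>v\<in>B. norm v = 1 \<and> f v = (v \<bullet> f v) *\<^sub>R v) \<and>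
             finite B \<and> card B = dim S"
  using S
proof (induction "dim S" arbitrary: S)
  case 0
  show ?case by (rule exI[of _ "{}"]) (use 0 in auto)
next
  case (Suc d)
  have "S \<noteq> {0}" using Suc.hyps(2) by auto
  then obtain v c where v: "v \<in> S" "norm v = 1" "f v = c *\<^sub>R v"
    using selfadjoint_eigenvector[OF f sa Suc.prems] by metis
  then have fv: "f v = (v \<bullet> f v) *\<^sub>R v" by (simp add: norm_eq_1)
  define T where "T = {x \<in> S. orthogonal v x}"
  have T: "subspace T"
    using Suc.prems(1) by (auto simp: T_def subspace_def orthogonal_def inner_add_right)
  have "v \<bullet> f x = 0" if "v \<bullet> x = 0" for x
    using sa[of v x] v(3) that by simp
  then have "f ` T \<subseteq> T"
    using Suc.prems(2) by (auto simp: T_def orthogonal_def)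
  note T = T this
  have "dim S = dim T + dim (span {v})"
  proof -
    have "{y \<in> S. \<forall>x\<in>span {v}. orthogonal x y} = T"
      by (auto simp: T_def span_singleton orthogonal_def dest: spec[of _ 1])
    moreover have "span {v} \<subseteq> S" using v(1) Suc.prems(1) by (simp add: span_minimal)
    ultimately show ?thesis
      using dim_subspace_orthogonal_to_vectors[OF subspace_span Suc.prems(1), of "{v}"] by simp
  qed
  moreover have "dim (span {v}) = 1" using v by auto
  ultimately have "d = dim T" using Suc.hyps(2) by simp
  from Suc.hyps(1)[OF this T] obtain B where B: "B \<subseteq> T" "pairwise orthogonal B"
    "\<forall>v\<in>B. norm v = 1 \<and> f v = (v \<bullet> f v) *\<^sub>R v" "finite B" "card B = d"
    using \<open>d = dim T\<close> by auto
  have "v \<notin> B" using B(1) v(2) by (auto simp: T_def orthogonal_def)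
  then have "card (insert v B) = dim S" using B Suc.hyps(2) by simp
  moreover have "pairwise orthogonal (insert v B)"
    using B(1,2) by (auto simp: pairwise_insert T_def orthogonal_commute)
  ultimately show ?case
    using B v fv by (intro exI[of _ "insert v B"]) (auto simp: T_def)
qed

lemma selfadjoint_sorted_eigenbasis:
  fixes f :: "'a::euclidean_space \<Rightarrow> 'a"
  assumes f: "linear f" and sa: "\<And>x y. f x \<bullet> y = x \<bullet> f y"
  obtains u :: "nat \<Rightarrow> 'a" and l :: "nat \<Rightarrow> real"
  where "\<And>i. i < DIM('a) \<Longrightarrow> f (u i) = l i *\<^sub>R u i"
    and "\<And>i j. i < DIM('a) \<Longrightarrow> j < DIM('a) \<Longrightarrow> u i \<bullet> u j = (if i = j then 1 else 0)"
    and "\<And>i j. i \<le> j \<Longrightarrow> j < DIM('a) \<Longrightarrow> l i \<le> l j"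
    and "\<And>x. (\<Sum>i<DIM('a). (x \<bullet> u i) *\<^sub>R u i) = x"
proof -
  obtain B where B: "pairwise orthogonal B" "\<And>v. v \<in> B \<Longrightarrow> norm v = 1"
    "\<And>v. v \<in> B \<Longrightarrow> f v = (v \<bullet> f v) *\<^sub>R v" "finite B" "card B = DIM('a)"
    using selfadjoint_eigenbasis[OF f sa subspace_UNIV] by (auto simp: dim_UNIV)
  obtain ys where ys: "set ys = B" "distinct ys" using B(4) finite_distinct_list by blast
  define us where "us = sort_key (\<lambda>v. v \<bullet> f v) ys"
  have us: "set us = B" "distinct us" "length us = DIM('a)" "sorted (map (\<lambda>v. v \<bullet> f v) us)"
    using ys B(5) distinct_card[of ys] by (auto simp: us_def)
  define u where "u i = us ! i" for i
  have bij: "bij_betw u {..<DIM('a)} B"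
    using us by (auto simp: u_def[abs_def] intro: bij_betw_nth)
  have uB: "u i \<in> B" if "i < DIM('a)" for i using that us by (auto simp: u_def)
  show thesis
  proof (rule that[of u "\<lambda>i. u i \<bullet> f (u i)"])
    show "f (u i) = (u i \<bullet> f (u i)) *\<^sub>R u i" if "i < DIM('a)" for i
      using B(3)[OF uB[OF that]] .
    show "u i \<bullet> u j = (if i = j then 1 else 0)" if "i < DIM('a)" "j < DIM('a)" for i j
    proof (cases "i = j")
      case True then show ?thesis using B(2)[OF uB[OF that(1)]] by (simp add: norm_eq_1)
    next
      case False
      then have "u i \<noteq> u j" using us that by (simp add: u_def nth_eq_iff_index_eq)
      then show ?thesis using False B(1) uB that by (auto simp: pairwise_def orthogonal_def)
    qed
    show "u i \<bullet> f (u i) \<le> u j \<bullet> f (u j)" if "i \<le> j" "j < DIM('a)" for i j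
      using sorted_nth_mono[OF us(4) that(1)] that us(3) by (simp add: u_def)
    have "independent B"
      using B(1) B(2)[of 0] by (intro pairwise_orthogonal_independent) auto
    then have "span B = UNIV"
      using B(4,5) card_eq_dim[of B UNIV] by (auto simp: dim_UNIV)
    then have "(\<Sum>v\<in>B. (x \<bullet> v) *\<^sub>R v) = x" for x
      using orthonormal_basis_expand[OF B(1,2) _ B(4)] by auto
    then show "(\<Sum>i<DIM('a). (x \<bullet> u i) *\<^sub>R u i) = x" for x
      using sum.reindex_bij_betw[OF bij, of "\<lambda>v. (x \<bullet> v) *\<^sub>R v"] by simp
  qed
qed

section \<open>Characteristic polynomial and sorted eigenvalues\<close>

text \<open>With the eigenvectors as columns of \<open>P\<close>, \<open>X ** P = P ** L\<close>
  holds over the polynomial ring, an integral domain. The dual family \<open>q\<close> gives a left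
  inverse of \<open>P\<close>, so \<open>det P\<close> is nonzero and cancels.\<close>

lemma charpoly_diagonalizable:
  fixes M :: "real ^ 'v ^ 'v" and p q :: "'v \<Rightarrow> real ^ 'v"
  assumes eig: "\<And>j. M *v p j = l j *\<^sub>R p j"
    and dual: "\<And>i j. q i \<bullet> p j = (if i = j then 1 else 0)"
  shows "charpoly M = (\<Prod>i\<in>UNIV. [:- l i, 1:])"
proof -
  define P :: "real poly ^ 'v ^ 'v" where "P = (\<chi> i j. [:p j $ i:])"
  define Q :: "real poly ^ 'v ^ 'v" where "Q = (\<chi> i j. [:q i $ j:])"
  define X :: "real poly ^ 'v ^ 'v" where
    "X = (\<chi> i j. (if i = j then [:0, 1:] else 0) - [:M $ i $ j:])"
  define L :: "real poly ^ 'v ^ 'v" where "L = (\<chi> i j. if i = j then [:- l i, 1:] else 0)"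
  have sum_const: "(\<Sum>k\<in>A. [:f k:]) = [:\<Sum>k\<in>A. f k:]" for A and f :: "'v \<Rightarrow> real"
    by (induction A rule: infinite_finite_induct) auto
  have QP: "Q ** P = mat 1"
    unfolding Q_def P_def matrix_matrix_mult_def mat_def
    using dual by (simp add: vec_eq_iff sum_const inner_vec_def mult.commute one_pCons)
  have "X ** P = P ** L"
  proof -
    have "(X ** P) $ i $ j = (P ** L) $ i $ j" for i j
    proof -
      have "(\<Sum>k\<in>UNIV. M $ i $ k * p j $ k) = l j * p j $ i"
        using eig[of j] by (simp add: vec_eq_iff matrix_vector_mult_def)
      moreover have "(X ** P) $ i $ j = [:0, 1:] * [:p j $ i:] - [:\<Sum>k\<in>UNIV. M $ i $ k * p j $ k:]"
      proof -
        have "(X ** P) $ i $ j = (\<Sum>k\<in>UNIV. (if i = k then [:0, 1:] * [:p j $ k:] else 0) - [:M $ i $ k * p j $ k:])"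
          unfolding X_def P_def matrix_matrix_mult_def by (auto simp: left_diff_distrib intro!: sum.cong)
        then show ?thesis by (simp add: sum_subtractf sum_const)
      qed
      moreover have "(P ** L) $ i $ j = [:p j $ i:] * [:- l j, 1:]"
        by (simp add: L_def P_def matrix_matrix_mult_def 
            if_distrib[where f = "\<lambda>x. _ * x"] cong: if_cong)
      ultimately show ?thesis by simp
    qed
    then show ?thesis by (simp add: vec_eq_iff)
  qed
  then have "det X * det P = det P * det L" by (metis det_mul)
  moreover have "det Q * det P = 1" using QP det_mul[of Q P] by simp
  then have "det P \<noteq> 0" by auto
  ultimately have "det X = det L" by (simp add: mult.commute)
  also have "det L = (\<Prod>i\<in>UNIV. [:- l i, 1:])"
    by (subst det_diagonal) (auto simp: L_def)
  finally show ?thesis by (simp add: charpoly_def X_def)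
qed

text \<open>The roots with multiplicity are the multiset of the \<open>l i\<close>; as
  \<open>l\<close> is already increasing, sorting returns the list itself. \<open>Suc m\<close>
  reconciles the index from 0 with the count from 1.\<close>

lemma eigenvalue_diagonalizable:
  fixes M :: "real ^ 'v ^ 'v" and p q :: "nat \<Rightarrow> real ^ 'v"
  assumes eig: "\<And>j. j < CARD('v) \<Longrightarrow> M *v p j = l j *\<^sub>R p j"
    and dual: "\<And>i j. i < CARD('v) \<Longrightarrow> j < CARD('v) \<Longrightarrow> q i \<bullet> p j = (if i = j then 1 else 0)"
    and mono: "\<And>i j. i \<le> j \<Longrightarrow> j < CARD('v) \<Longrightarrow> l i \<le> l j"
    and m: "m < CARD('v)"
  shows "eigenvalue M (Suc m) = l m"
proof -
  obtain h :: "'v \<Rightarrow> nat" where h: "bij_betw h UNIV {..<CARD('v)}"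
    using ex_bij_betw_finite_nat[of "UNIV :: 'v set"] by (auto simp: atLeast0LessThan)
  have hl: "h i < CARD('v)" for i using h by (auto simp: bij_betw_def)
  have hi: "h i = h j \<longleftrightarrow> i = j" for i j using h by (auto simp: bij_betw_def inj_on_def)
  have "charpoly M = (\<Prod>i\<in>UNIV. [:- l (h i), 1:])"
    by (rule charpoly_diagonalizable[where p = "\<lambda>i. p (h i)" and q = "\<lambda>i. q (h i)"])
      (auto simp: eig hl dual hi)
  also have "\<dots> = (\<Prod>i<CARD('v). [:- l i, 1:])"
    by (rule prod.reindex_bij_betw[OF h])
  finally have "proots (charpoly M) = (\<Sum>i<CARD('v). {#l i#})"
    by (simp add: proots_prod)
  also have "\<dots> = mset (map l [0..<CARD('v)])"
    by (simp add: sum_unfold_sum_mset image_mset.compositionality lessThan_atLeast0)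
  finally have "sorted_list_of_multiset (proots (charpoly M)) = sort (map l [0..<CARD('v)])"
    by (simp only: sorted_list_of_multiset_mset)
  also have "\<dots> = map l [0..<CARD('v)]"
    by (intro sort_key_id_if_sorted) (auto simp: sorted_iff_nth_mono mono)
  finally show ?thesis using m by (simp add: eigenvalue_def)
qed
section \<open>Krasnoselskii genus\<close>

text \<open>If \<open>g\<close> had no zero, its normalisation would be an odd self-map of the
  sphere, hence of odd degree. But its coordinate \<open>n\<close> vanishes, so it misses a pole and
  has degree 0.\<close>

theorem Borsuk_Ulam_odd_map:
  assumes n: "n < DIM('a::euclidean_space)" and m: "m \<le> n"
    and g: "continuous_on (std_sphere n) (g :: _ \<Rightarrow> nat \<Rightarrow> real)"
    and odd: "\<And>x. x \<in> std_sphere n \<Longrightarrow> g (\<lambda>i. - x i) = (\<lambda>i. - g x i)"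
    and g0: "\<And>x i. x \<in> std_sphere n \<Longrightarrow> i \<ge> m \<Longrightarrow> g x i = 0"
  shows "\<exists>x\<in>std_sphere n. g x = (\<lambda>i. 0)"
proof (rule ccontr)
  assume "\<not> ?thesis"
  then have nz: "\<exists>i\<le>n. g x i \<noteq> 0" if "x \<in> std_sphere n" for x
    using that g0 m by (metis (full_types) ext le_trans nle_le)
  have c: "continuous_map (nsphere n) (nsphere n) (\<lambda>x. radial_proj n (g x))"
    using continuous_on_radial_proj[OF g nz] radial_proj_in_std_sphere[OF _ nz] g0 m
    by (auto simp: nsphere_std_sphere image_subset_iff)
  have "odd (Brouwer_degree2 n (\<lambda>x. radial_proj n (g x)))"
    by (rule Borsuk_odd_mapping_degree[OF n c]) (simp add: odd radial_proj_uminus)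
  moreover have "Brouwer_degree2 n (\<lambda>x. radial_proj n (g x)) = 0"
  proof (rule Brouwer_degree2_nonsurjective[OF c])
    have "(\<lambda>i. if i = n then 1 else 0) \<in> std_sphere n"
      by (auto simp: std_sphere_def if_distrib[where f = "\<lambda>x. x\<^sup>2"] cong: if_cong)
    moreover have "radial_proj n (g x) \<noteq> (\<lambda>i. if i = n then 1 else 0)" if "x \<in> std_sphere n" for x
      using g0[OF that m] by (auto simp: radial_proj_def dest: fun_cong[of _ _ n])
    ultimately show "(\<lambda>x. radial_proj n (g x)) ` topspace (nsphere n) \<noteq> topspace (nsphere n)"
      by (metis imageE topspace_nsphere_std_sphere)
  qed
  ultimately show False by simp
qed

text \<open>Composing with \<phi> turns an odd map from \<open>S\<close> into the punctured
  \<open>m\<close>-space into a zero-free odd map on the \<open>n\<close>-sphere, so Borsuk-Ulam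
  gives \<open>m > n\<close>.\<close>

lemma krasnoselskii_genus_ge:
  fixes S :: "'a::euclidean_space set"
  assumes n: "n < DIM('a)" and \<phi>: "continuous_on (std_sphere n) \<phi>" "\<phi> ` std_sphere n \<subseteq> S"
    and odd: "\<And>x. x \<in> std_sphere n \<Longrightarrow> \<phi> (\<lambda>i. - x i) = - \<phi> x"
  shows "enat (Suc n) \<le> krasnoselskii_genus S"
  unfolding krasnoselskii_genus_def
proof (rule Inf_greatest, clarify)
  fix m f
  assume f: "continuous_map (top_of_set S) (subtopology (Euclidean_space m) (- {\<lambda>i. 0})) f"
    and f_odd: "odd_map_on S f"
  have fc: "continuous_on S f" and f0: "\<And>x i. x \<in> S \<Longrightarrow> i \<ge> m \<Longrightarrow> f x i = 0"
    and fn: "\<And>x. x \<in> S \<Longrightarrow> f x \<noteq> (\<lambda>i. 0)"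
    using f unfolding continuous_map_in_subtopology Euclidean_space_def euclidean_product_topology
    by auto
  have "\<not> m \<le> n"
  proof
    assume "m \<le> n"
    have "\<exists>x\<in>std_sphere n. f (\<phi> x) = (\<lambda>i. 0)"
      by (rule Borsuk_Ulam_odd_map[OF n \<open>m \<le> n\<close>])
        (use \<phi> odd f_odd f0 in \<open>auto simp: odd_map_on_def image_subset_iff
          intro: continuous_on_compose2[OF fc]\<close>)
    then show False using fn \<phi>(2) by blast
  qed
  then show "enat (Suc n) \<le> enat m" by simp
qed

text \<open>Used in contraposition: on a set of genus above \<open>m\<close>, any \<open>m\<close>
  continuous odd functions have a common zero.\<close>

lemma krasnoselskii_genus_le:
  fixes S :: "'a::euclidean_space set"
  assumes g: "\<And>i. i < m \<Longrightarrow> continuous_on S (g i)"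
    and odd: "\<And>i x. i < m \<Longrightarrow> x \<in> S \<Longrightarrow> g i (- x) = - g i x"
    and nz: "\<And>x. x \<in> S \<Longrightarrow> \<exists>i<m. g i x \<noteq> (0::real)"
  shows "krasnoselskii_genus S \<le> enat m"
proof -
  define f where "f x i = (if i < m then g i x else 0)" for x i
  have "continuous_on S f"
  proof (rule continuous_on_coordinatewise_then_product)
    show "continuous_on S (\<lambda>x. f x i)" for i
      by (cases "i < m") (auto simp: f_def g)
  qed
  moreover have "f x \<noteq> (\<lambda>i. 0)" if "x \<in> S" for x
    using nz[OF that] by (metis f_def)
  ultimately have "continuous_map (top_of_set S) (subtopology (Euclidean_space m) (- {\<lambda>i. 0})) f"
    unfolding continuous_map_in_subtopology Euclidean_space_def euclidean_product_topology
    by (auto simp: f_def)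
  moreover have "odd_map_on S f"
    using odd by (auto simp: odd_map_on_def f_def)
  ultimately show ?thesis
    unfolding krasnoselskii_genus_def by (intro Inf_lower) blast
qed

section \<open>Signless energy and the normalized Laplacian\<close>

lemma sum_edges_vertices:
  "(\<Sum>e\<in>E. \<Sum>i\<in>e. g i) = (\<Sum>i\<in>UNIV. real (vertex_degree E i) * g i)" for E :: "'v::finite set set"
proof -
  have "(\<Sum>e\<in>E. \<Sum>i\<in>e. g i) = (\<Sum>e\<in>E. \<Sum>i\<in>UNIV. if i \<in> e then g i else 0)"
    by (simp add: sum.If_cases)
  also have "\<dots> = (\<Sum>i\<in>UNIV. \<Sum>e\<in>E. if i \<in> e then g i else 0)"
    by (rule sum.swap)
  also have "\<dots> = (\<Sum>i\<in>UNIV. real (vertex_degree E i) * g i)"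
    by (simp add: sum.If_cases vertex_degree_def Int_def)
  finally show ?thesis .
qed

text \<open>The form \<open>Q\<close> of the overview, that is, the quadratic form of D + A.\<close>

definition signless_energy :: "'v::finite set set \<Rightarrow> real ^ 'v \<Rightarrow> real" where
  "signless_energy E x = (\<Sum>e\<in>E. (\<Sum>i\<in>e. x $ i)\<^sup>2)"

text \<open>Expanding the squares counts, for each ordered pair \<open>(i, j)\<close>, the edges
  containing both vertices: the degree on the diagonal, the adjacency entry off it.\<close>

lemma signless_energy_eq:
  assumes E: "simple_graph E"
  shows "signless_energy E x = (\<Sum>i\<in>UNIV. real (vertex_degree E i) * (x $ i)\<^sup>2)
     + (\<Sum>i\<in>UNIV. \<Sum>j\<in>UNIV. adjacency_matrix E $ i $ j * x $ i * x $ j)"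
proof -
  have pair: "{e \<in> E. i \<in> e \<and> j \<in> e} = (if {i, j} \<in> E then {{i, j}} else {})" if "i \<noteq> j" for i j
  proof -
    have "e = {i, j}" if e: "e \<in> E" "i \<in> e" "j \<in> e" for e
    proof -
      have "card e = 2" using E e by (auto simp: simple_graph_def)
      then obtain a b where "e = {a, b}" by (auto simp: card_2_iff)
      then show ?thesis using e \<open>i \<noteq> j\<close> by blast
    qed
    then have "e \<in> E \<and> i \<in> e \<and> j \<in> e \<longleftrightarrow> e \<in> E \<and> e = {i, j}" for e by blast
    then have "{e \<in> E. i \<in> e \<and> j \<in> e} = {e \<in> E. e = {i, j}}" by simp
    then show ?thesis by auto
  qed
  have loop: "{i} \<notin> E" for i using E by (force simp: simple_graph_def)
  have "signless_energy E x = (\<Sum>e\<in>E. \<Sum>i\<in>UNIV. \<Sum>j\<in>UNIV. if i \<in> e \<and> j \<in> e then x $ i * x $ j else 0)"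
  proof -
    have "(\<Sum>i\<in>e. x $ i)\<^sup>2 = (\<Sum>i\<in>UNIV. \<Sum>j\<in>UNIV. if i \<in> e \<and> j \<in> e then x $ i * x $ j else 0)" for e
    proof -
      have "(\<Sum>i\<in>e. x $ i) = (\<Sum>i\<in>UNIV. if i \<in> e then x $ i else 0)"
        by (simp add: sum.If_cases)
      then show ?thesis
        by (auto simp: power2_eq_square sum_product intro!: sum.cong)
    qed
    then show ?thesis by (simp add: signless_energy_def)
  qed
  also have "\<dots> = (\<Sum>i\<in>UNIV. \<Sum>j\<in>UNIV. \<Sum>e\<in>E. if i \<in> e \<and> j \<in> e then x $ i * x $ j else 0)"
    by (subst sum.swap) (intro sum.cong refl sum.swap)
  also have "\<dots> = (\<Sum>i\<in>UNIV. \<Sum>j\<in>UNIV. real (card {e \<in> E. i \<in> e \<and> j \<in> e}) * (x $ i * x $ j))"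
    by (simp add: sum.If_cases Int_def)
  also have "\<dots> = (\<Sum>i\<in>UNIV. \<Sum>j\<in>UNIV. (if i = j then real (vertex_degree E i) * (x $ i)\<^sup>2 else 0)
      + adjacency_matrix E $ i $ j * x $ i * x $ j)"
    by (intro sum.cong refl)
      (auto simp: pair adjacency_matrix_def loop vertex_degree_def power2_eq_square)
  finally show ?thesis by (simp add: sum.distrib)
qed

section \<open>Edgewise comparison of \<open>I_plus\<close> with the energy\<close>

lemma abs_add_signed_squares:
  fixes a b :: real
  assumes "0 \<le> a * b"
  shows "\<bar>a * \<bar>a\<bar> + b * \<bar>b\<bar>\<bar> = a\<^sup>2 + b\<^sup>2"
proof -
  consider "0 \<le> a" "0 \<le> b" | "a \<le> 0" "b \<le> 0"
    using assms by (auto simp: zero_le_mult_iff)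
  then show ?thesis
  proof cases
    case 2
    then have "a * \<bar>a\<bar> + b * \<bar>b\<bar> = - (a\<^sup>2 + b\<^sup>2)" by (simp add: power2_eq_square)
    then have "\<bar>a * \<bar>a\<bar> + b * \<bar>b\<bar>\<bar> = \<bar>a\<^sup>2 + b\<^sup>2\<bar>" by (metis abs_minus_cancel)
    then show ?thesis by simp
  qed (simp add: power2_eq_square)
qed

text \<open>Cauchy-Schwarz over the edges, after bounding each summand by \<bar>a + b\<bar>
  (\<bar>a\<bar> + \<bar>b\<bar>). For equal signs this is an equality of squares; for opposite
  signs the summand factors as \<bar>a + b\<bar> \<bar>a - b\<bar>.\<close>

lemma I_plus_le_energy:
  assumes E: "simple_graph E"
  shows "I_plus E (\<chi> i. x $ i * \<bar>x $ i\<bar>)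
    \<le> sqrt (signless_energy E x) * sqrt (2 * (\<Sum>i\<in>UNIV. real (vertex_degree E i) * (x $ i)\<^sup>2))"
proof -
  have edge: "\<bar>\<Sum>i\<in>e. x $ i * \<bar>x $ i\<bar>\<bar> \<le> \<bar>\<Sum>i\<in>e. x $ i\<bar> * \<bar>\<Sum>i\<in>e. \<bar>x $ i\<bar>\<bar>"
    "(\<Sum>i\<in>e. \<bar>x $ i\<bar>)\<^sup>2 \<le> 2 * (\<Sum>i\<in>e. (x $ i)\<^sup>2)" if "e \<in> E" for e
  proof -
    have "card e = 2" using E that by (auto simp: simple_graph_def)
    then obtain i j where e: "e = {i, j}" "i \<noteq> j" by (auto simp: card_2_iff)
    have 1: "\<bar>a * \<bar>a\<bar> + b * \<bar>b\<bar>\<bar> \<le> \<bar>a + b\<bar> * (\<bar>a\<bar> + \<bar>b\<bar>)" for a b :: real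
    proof (cases "a * b \<ge> 0")
      case True
      then have "\<bar>a\<bar> + \<bar>b\<bar> = \<bar>a + b\<bar>"
        by (auto simp: zero_le_mult_iff)
      then show ?thesis
        using True by (simp add: abs_add_signed_squares power2_eq_square algebra_simps)
    next
      case False
      then have "\<bar>a * \<bar>a\<bar> + b * \<bar>b\<bar>\<bar> = \<bar>(a + b) * (a - b)\<bar>" "\<bar>a\<bar> + \<bar>b\<bar> = \<bar>a - b\<bar>"
        by (auto simp: not_le mult_less_0_iff algebra_simps)
      then show ?thesis by (simp add: abs_mult)
    qed
    show "\<bar>\<Sum>i\<in>e. x $ i * \<bar>x $ i\<bar>\<bar> \<le> \<bar>\<Sum>i\<in>e. x $ i\<bar> * \<bar>\<Sum>i\<in>e. \<bar>x $ i\<bar>\<bar>"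
      using 1 e by simp
    have "(a + b)\<^sup>2 \<le> 2 * (a\<^sup>2 + b\<^sup>2)" for a b :: real
      using zero_le_power2[of "a - b"] by (simp add: power2_eq_square algebra_simps)
    from this[of "\<bar>x $ i\<bar>" "\<bar>x $ j\<bar>"] show "(\<Sum>i\<in>e. \<bar>x $ i\<bar>)\<^sup>2 \<le> 2 * (\<Sum>i\<in>e. (x $ i)\<^sup>2)"
      using e by simp
  qed
  have "I_plus E (\<chi> i. x $ i * \<bar>x $ i\<bar>) \<le> (\<Sum>e\<in>E. \<bar>\<Sum>i\<in>e. x $ i\<bar> * \<bar>\<Sum>i\<in>e. \<bar>x $ i\<bar>\<bar>)"
    unfolding I_plus_def by (intro sum_mono) (use edge in simp)
  also have "\<dots> \<le> L2_set (\<lambda>e. \<Sum>i\<in>e. x $ i) E * L2_set (\<lambda>e. \<Sum>i\<in>e. \<bar>x $ i\<bar>) E"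
    by (rule L2_set_mult_ineq)
  also have "\<dots> \<le> sqrt (signless_energy E x) * sqrt (\<Sum>e\<in>E. 2 * (\<Sum>i\<in>e. (x $ i)\<^sup>2))"
    unfolding L2_set_def signless_energy_def
    by (intro mult_left_mono real_sqrt_le_mono sum_mono edge) (auto simp: sum_nonneg)
  also have "(\<Sum>e\<in>E. 2 * (\<Sum>i\<in>e. (x $ i)\<^sup>2)) = 2 * (\<Sum>i\<in>UNIV. real (vertex_degree E i) * (x $ i)\<^sup>2)"
    by (simp add: sum_edges_vertices flip: sum_distrib_left)
  finally show ?thesis .
qed

text \<open>Holds edge by edge: equal signs reduce to the bound of the squared sum by twice the sum
  of squares, opposite signs to \<bar>a + b\<bar> \<le> \<bar>a - b\<bar>.\<close>

lemma energy_le_I_plus: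
  assumes E: "simple_graph E"
  shows "signless_energy E x \<le> 2 * I_plus E (\<chi> i. x $ i * \<bar>x $ i\<bar>)"
  unfolding signless_energy_def I_plus_def sum_distrib_left
proof (rule sum_mono)
  fix e assume "e \<in> E"
  then have "card e = 2" using E by (auto simp: simple_graph_def)
  then obtain i j where e: "e = {i, j}" "i \<noteq> j" by (auto simp: card_2_iff)
  have "(a + b)\<^sup>2 \<le> 2 * \<bar>a * \<bar>a\<bar> + b * \<bar>b\<bar>\<bar>" for a b :: real
  proof (cases "a * b \<ge> 0")
    case True
    then have "\<bar>a * \<bar>a\<bar> + b * \<bar>b\<bar>\<bar> = a\<^sup>2 + b\<^sup>2"
      by (rule abs_add_signed_squares)
    moreover have "(a + b)\<^sup>2 \<le> 2 * (a\<^sup>2 + b\<^sup>2)"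
      using zero_le_power2[of "a - b"] by (simp add: power2_eq_square algebra_simps)
    ultimately show ?thesis by simp
  next
    case False
    then have "\<bar>a * \<bar>a\<bar> + b * \<bar>b\<bar>\<bar> = \<bar>a + b\<bar> * \<bar>a - b\<bar>" "\<bar>a + b\<bar> \<le> \<bar>a - b\<bar>"
      by (auto simp: not_le mult_less_0_iff algebra_simps simp flip: abs_mult)
    moreover from this(2) have "\<bar>a + b\<bar> * \<bar>a + b\<bar> \<le> \<bar>a + b\<bar> * \<bar>a - b\<bar>"
      by (rule mult_left_mono) simp
    moreover have "0 \<le> \<bar>a + b\<bar> * \<bar>a - b\<bar>" by simp
    ultimately have "\<bar>a + b\<bar> * \<bar>a + b\<bar> \<le> 2 * \<bar>a * \<bar>a\<bar> + b * \<bar>b\<bar>\<bar>" by linarith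
    then show ?thesis by (simp add: power2_eq_square)
  qed
  then show "(\<Sum>i\<in>e. x $ i)\<^sup>2 \<le> 2 * \<bar>\<Sum>i\<in>e. (\<chi> i. x $ i * \<bar>x $ i\<bar>) $ i\<bar>"
    using e by simp
qed

section \<open>Symmetrisation of the normalized Laplacian\<close>

text \<open>The matrix \<open>I - D^(-1/2) A D^(-1/2)\<close>, similar to
  \<open>normalized_laplacian\<close> but symmetric, so the spectral theorem applies.\<close>

definition symmetric_laplacian :: "'v::finite set set \<Rightarrow> real ^ 'v ^ 'v" where
  "symmetric_laplacian E = (\<chi> i j. (if i = j then 1 else 0)
     - adjacency_matrix E $ i $ j / (sqrt (vertex_degree E i) * sqrt (vertex_degree E j)))"

lemma symmetric_laplacian_selfadjoint:
  "(symmetric_laplacian E *v x) \<bullet> y = x \<bullet> (symmetric_laplacian E *v y)"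
proof -
  have "transpose (symmetric_laplacian E) = symmetric_laplacian E"
    by (simp add: transpose_def symmetric_laplacian_def adjacency_matrix_def vec_eq_iff
        insert_commute mult.commute eq_commute)
  then show ?thesis by (metis dot_lmul_matrix vector_transpose_matrix)
qed

lemma vertex_degree_pos:
  "no_isolated_vertices E \<Longrightarrow> vertex_degree E i > 0" for E :: "'v::finite set set"
  by (auto simp: no_isolated_vertices_def vertex_degree_def card_gt_0_iff)

text \<open>Multiplication by \<open>D^(1/2)\<close>; it turns the degree-weighted norm into the
  Euclidean one.\<close>

definition scale_degree :: "'v::finite set set \<Rightarrow> real ^ 'v \<Rightarrow> real ^ 'v" where
  "scale_degree E x = (\<chi> i. sqrt (vertex_degree E i) * x $ i)"

definition unscale_degree :: "'v::finite set set \<Rightarrow> real ^ 'v \<Rightarrow> real ^ 'v" where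
  "unscale_degree E z = (\<chi> i. z $ i / sqrt (vertex_degree E i))"

lemma scale_unscale:
  assumes "no_isolated_vertices E"
  shows "scale_degree E (unscale_degree E z) = z" "unscale_degree E (scale_degree E z) = z"
  using vertex_degree_pos[OF assms]
  by (simp_all add: scale_degree_def unscale_degree_def vec_eq_iff less_imp_neq[symmetric])

lemma inner_scale_unscale:
  assumes "no_isolated_vertices E"
  shows "scale_degree E x \<bullet> unscale_degree E y = x \<bullet> y"
  using vertex_degree_pos[OF assms]
  by (simp add: scale_degree_def unscale_degree_def inner_vec_def less_imp_neq[symmetric])

lemma norm_scale:
  "scale_degree E x \<bullet> scale_degree E x = (\<Sum>i\<in>UNIV. real (vertex_degree E i) * (x $ i)\<^sup>2)"
proof -
  have "sqrt (vertex_degree E i) * x $ i * (sqrt (vertex_degree E i) * x $ i)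
    = (sqrt (vertex_degree E i) * sqrt (vertex_degree E i)) * (x $ i)\<^sup>2" for i
    by (simp only: power2_eq_square ac_simps)
  then show ?thesis by (simp add: scale_degree_def inner_vec_def)
qed

lemma normalized_laplacian_nth:
  assumes "no_isolated_vertices E"
  shows "normalized_laplacian E $ i $ j
    = (if i = j then 1 else 0) - adjacency_matrix E $ i $ j / vertex_degree E i"
proof -
  let ?D = "(\<chi> i j. if i = j then 1 / real (vertex_degree E i) else 0) :: real ^ 'a ^ 'a"
  have "degree_matrix E ** ?D = mat 1" "?D ** degree_matrix E = mat 1"
    using vertex_degree_pos[OF assms]
    by (simp_all add: degree_matrix_def matrix_matrix_mult_def mat_def vec_eq_iff less_imp_neq[symmetric]
        if_distrib[where f = "\<lambda>x. x * _"] if_distrib[where f = "\<lambda>x. _ * x"] cong: if_cong)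
  \<comment> \<open>\<open>matrix_inv\<close> is a choice: the explicit inverse shows that the
    choice succeeds, and uniqueness of inverses then identifies the two.\<close>
  then have "degree_matrix E ** matrix_inv (degree_matrix E) = mat 1"
    unfolding matrix_inv_def
    using someI[of "\<lambda>B. degree_matrix E ** B = mat 1 \<and> B ** degree_matrix E = mat 1" ?D] by simp
  then have "?D ** (degree_matrix E ** matrix_inv (degree_matrix E)) = ?D"
    by (simp only: matrix_mul_rid)
  then have "matrix_inv (degree_matrix E) = ?D"
    by (simp only: matrix_mul_assoc \<open>?D ** degree_matrix E = mat 1\<close> matrix_mul_lid)
  then show ?thesis
    by (simp add: normalized_laplacian_def matrix_matrix_mult_def mat_def
        if_distrib[where f = "\<lambda>x. x * _"] cong: if_cong)
qed

lemma normalized_laplacian_unscale: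
  assumes iso: "no_isolated_vertices E"
  shows "normalized_laplacian E *v unscale_degree E z = unscale_degree E (symmetric_laplacian E *v z)"
proof -
  have "normalized_laplacian E $ i $ j * (z $ j / sqrt (vertex_degree E j))
      = symmetric_laplacian E $ i $ j * z $ j / sqrt (vertex_degree E i)" for i j
  proof -
    have "real (vertex_degree E i) = sqrt (vertex_degree E i) * sqrt (vertex_degree E i)" by simp
    then show ?thesis
      unfolding normalized_laplacian_nth[OF iso] symmetric_laplacian_def
      using vertex_degree_pos[OF iso, of i] vertex_degree_pos[OF iso, of j]
      by (simp add: left_diff_distrib diff_divide_distrib mult_ac)
  qed
  then show ?thesis
    by (simp add: vec_eq_iff matrix_vector_mult_def unscale_degree_def sum_divide_distrib)
qed

text \<open>Conjugating D + A by \<open>D^(-1/2)\<close> gives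
  \<open>I + D^(-1/2) A D^(-1/2)\<close>, which is 2 minus the symmetric Laplacian.\<close>

lemma signless_energy_rayleigh:
  assumes E: "simple_graph E" and iso: "no_isolated_vertices E"
  shows "signless_energy E (unscale_degree E z) = 2 * (z \<bullet> z) - z \<bullet> (symmetric_laplacian E *v z)"
proof -
  let ?x = "unscale_degree E z"
  have "z \<bullet> z = (\<Sum>i\<in>UNIV. real (vertex_degree E i) * (?x $ i)\<^sup>2)"
    using norm_scale[of E ?x] by (simp add: scale_unscale[OF iso])
  moreover have "z \<bullet> (symmetric_laplacian E *v z)
    = z \<bullet> z - (\<Sum>i\<in>UNIV. \<Sum>j\<in>UNIV. adjacency_matrix E $ i $ j * ?x $ i * ?x $ j)"
  proof -
    have "z $ i * (symmetric_laplacian E *v z) $ i = z $ i * z $ i - (\<Sum>j\<in>UNIV. adjacency_matrix E $ i $ j * ?x $ i * ?x $ j)" for i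
    proof -
      have "(symmetric_laplacian E *v z) $ i = (\<Sum>j\<in>UNIV. (if i = j then z $ j else 0)
          - adjacency_matrix E $ i $ j * (z $ j / (sqrt (vertex_degree E i) * sqrt (vertex_degree E j))))"
        unfolding matrix_vector_mult_def symmetric_laplacian_def
        by (auto simp: left_diff_distrib intro!: sum.cong)
      also have "\<dots> = z $ i - (\<Sum>j\<in>UNIV. adjacency_matrix E $ i $ j * (z $ j / (sqrt (vertex_degree E i) * sqrt (vertex_degree E j))))"
        by (simp add: sum_subtractf)
      finally show ?thesis
        by (simp add: right_diff_distrib sum_distrib_left unscale_degree_def mult_ac)
    qed
    then show ?thesis by (simp add: inner_vec_def sum_subtractf)
  qed
  ultimately show ?thesis
    using signless_energy_eq[OF E, of ?x] by simp
qed

lemma eigenbasis_quadratic_form: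
  fixes f :: "'a::euclidean_space \<Rightarrow> 'a" and u :: "nat \<Rightarrow> 'a"
  assumes f: "linear f" and eig: "\<And>i. i < n \<Longrightarrow> f (u i) = l i *\<^sub>R u i"
    and expand: "\<And>x. (\<Sum>i<n. (x \<bullet> u i) *\<^sub>R u i) = x"
  shows "x \<bullet> f x = (\<Sum>i<n. l i * (x \<bullet> u i)\<^sup>2)" and "x \<bullet> x = (\<Sum>i<n. (x \<bullet> u i)\<^sup>2)"
proof -
  have "f x = (\<Sum>i<n. (x \<bullet> u i) *\<^sub>R f (u i))"
    by (subst (1) expand[of x, symmetric]) (simp add: linear_sum[OF f] linear_scale[OF f])
  then show "x \<bullet> f x = (\<Sum>i<n. l i * (x \<bullet> u i)\<^sup>2)"
    by (simp add: eig inner_sum_right power2_eq_square mult_ac)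
  show "x \<bullet> x = (\<Sum>i<n. (x \<bullet> u i)\<^sup>2)"
    by (subst (2) expand[of x, symmetric]) (simp add: inner_sum_right power2_eq_square)
qed

section \<open>The change of variables between the two unit spheres\<close>

definition signed_square :: "real ^ 'v \<Rightarrow> real ^ 'v" where
  "signed_square x = (\<chi> i. x $ i * \<bar>x $ i\<bar>)"

text \<open>\<open>sqrt\<close> is an odd function on all reals here, so this inverts
  \<open>signed_square\<close> without a case split on signs.\<close>

definition signed_sqrt :: "real ^ 'v \<Rightarrow> real ^ 'v" where
  "signed_sqrt y = (\<chi> i. sqrt (y $ i))"

lemma signed_square_sqrt: "signed_square (signed_sqrt y) = y"
proof -
  have "sqrt t * \<bar>sqrt t\<bar> = t" for t
  proof (cases "0 \<le> t")
    case False
    then have "\<bar>sqrt t\<bar> = sqrt (- t)" "sqrt t = - sqrt (- t)" by (simp_all add: real_sqrt_minus)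
    then have "sqrt t * \<bar>sqrt t\<bar> = - (sqrt (- t) * sqrt (- t))" by simp
    then show ?thesis using False by simp
  qed simp
  then show ?thesis by (simp add: signed_square_def signed_sqrt_def vec_eq_iff)
qed

lemma in_unit_sphere_1_iff:
  "signed_square x \<in> unit_sphere_1 E \<longleftrightarrow> scale_degree E x \<bullet> scale_degree E x = 1"
  by (simp add: unit_sphere_1_def signed_square_def norm_scale abs_mult power2_eq_square)

section \<open>The test set and the bound for arbitrary sets of large genus\<close>

text \<open>The test set comes from the unit sphere in the span of the eigenvectors for the
  \<open>k\<close> largest eigenvalues. There the Rayleigh quotient is at least
  \<open>l (CARD('v) - k)\<close>, which bounds the energy and hence \<open>I_plus\<close> from
  above.\<close>

lemma minmax_upper_set:
  fixes E :: "'v::finite set set" and u :: "nat \<Rightarrow> real ^ 'v"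
  assumes E: "simple_graph E" and iso: "no_isolated_vertices E"
    and k: "1 \<le> k" "k \<le> CARD('v)"
    and eig: "\<And>i. i < CARD('v) \<Longrightarrow> symmetric_laplacian E *v u i = l i *\<^sub>R u i"
    and ortho: "\<And>i j. i < CARD('v) \<Longrightarrow> j < CARD('v) \<Longrightarrow> u i \<bullet> u j = (if i = j then 1 else 0)"
    and mono: "\<And>i j. i \<le> j \<Longrightarrow> j < CARD('v) \<Longrightarrow> l i \<le> l j"
    and expand: "\<And>x. (\<Sum>i<CARD('v). (x \<bullet> u i) *\<^sub>R u i) = x"
  obtains S where "S \<subseteq> unit_sphere_1 E" "compact S" "S = uminus ` S"
    "enat k \<le> krasnoselskii_genus S"
    "\<And>y. y \<in> S \<Longrightarrow> I_plus E y \<le> sqrt (2 - l (CARD('v) - k)) * sqrt 2"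
    "S \<noteq> {}" "l (CARD('v) - k) \<le> 2"
proof -
  \<comment> \<open>Eigenvalues are indexed from 0, so \<open>l m\<close> is the eigenvalue of
    number \<open>CARD('v) - k + 1\<close>. The vectors used are \<open>u m\<close> to
    \<open>u (m + n)\<close>, and the sphere has dimension \<open>n = k - 1\<close>.\<close>
  define m where "m = CARD('v) - k"
  define n where "n = k - 1"
  have nk: "k = Suc n" "m + n < CARD('v)" using k by (auto simp: n_def m_def)
  define z where "z a = (\<Sum>j\<le>n. a j *\<^sub>R u (m + j))" for a :: "nat \<Rightarrow> real"
  define \<phi> where "\<phi> a = signed_square (unscale_degree E (z a))" for a
  have xc: "continuous_on A (\<lambda>x. x i)" for A :: "(nat \<Rightarrow> real) set" and i
    by (intro continuous_on_subset[OF continuous_on_product_coordinates]) auto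
  have zc: "continuous_on A z" for A
    unfolding z_def by (intro continuous_intros xc)
  have \<phi>c: "continuous_on A \<phi>" for A
    unfolding \<phi>_def signed_square_def unscale_degree_def
    using vertex_degree_pos[OF iso]
    by (auto intro!: continuous_intros zc simp: less_imp_neq[symmetric])
  have \<phi>_neg: "\<phi> (\<lambda>i. - a i) = - \<phi> a" for a
    by (simp add: \<phi>_def z_def signed_square_def unscale_degree_def sum_negf vec_eq_iff)
  have zu: "z a \<bullet> u i = (if m \<le> i \<and> i \<le> m + n then a (i - m) else 0)" if "i < CARD('v)" for a i
  proof -
    have "z a \<bullet> u i = (\<Sum>j\<le>n. if m + j = i then a j else 0)"
      unfolding z_def inner_sum_left using nk that by (intro sum.cong) (auto simp: ortho)
    also have "\<dots> = (\<Sum>j\<le>n. if j = i - m then if m \<le> i then a j else 0 else 0)"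
      by (intro sum.cong) auto
    finally show ?thesis by auto
  qed
  have quad: "x \<bullet> (symmetric_laplacian E *v x) = (\<Sum>i<CARD('v). l i * (x \<bullet> u i)\<^sup>2)"
    "x \<bullet> x = (\<Sum>i<CARD('v). (x \<bullet> u i)\<^sup>2)" for x
    using eigenbasis_quadratic_form[of "(*v) (symmetric_laplacian E)" "CARD('v)" u l x] eig expand
    by auto
  have zz: "z a \<bullet> z a = 1" if "a \<in> std_sphere n" for a
  proof -
    have "z a \<bullet> z a = (\<Sum>j\<le>n. a j * (z a \<bullet> u (m + j)))"
      by (subst (2) z_def) (simp add: inner_sum_right)
    also have "\<dots> = (\<Sum>j\<le>n. (a j)\<^sup>2)"
      using nk by (intro sum.cong) (auto simp: zu power2_eq_square)
    finally show ?thesis using that by (simp add: std_sphere_def)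
  qed
  have energy: "signless_energy E (unscale_degree E (z a)) \<le> 2 - l m" if "a \<in> std_sphere n" for a
  proof -
    have "l m * (z a \<bullet> z a) \<le> z a \<bullet> (symmetric_laplacian E *v z a)"
      unfolding quad[of "z a"] sum_distrib_left
      by (intro sum_mono) (auto simp: zu mono intro!: mult_right_mono)
    then show ?thesis using zz[OF that] by (simp add: signless_energy_rayleigh[OF E iso])
  qed
  show thesis
  proof (rule that[of "\<phi> ` std_sphere n"])
    show "\<phi> ` std_sphere n \<subseteq> unit_sphere_1 E"
      by (auto simp: \<phi>_def in_unit_sphere_1_iff scale_unscale[OF iso] zz)
    show "compact (\<phi> ` std_sphere n)"
      by (rule compact_continuous_image[OF \<phi>c compact_std_sphere])
    have "- \<phi> a \<in> \<phi> ` std_sphere n" if "a \<in> std_sphere n" for a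
      using uminus_std_sphere[OF that] \<phi>_neg[of a] by (metis imageI)
    then show "\<phi> ` std_sphere n = uminus ` \<phi> ` std_sphere n"
      by (auto simp: image_iff) (metis minus_minus)+
    show "enat k \<le> krasnoselskii_genus (\<phi> ` std_sphere n)"
      unfolding nk by (rule krasnoselskii_genus_ge[OF _ \<phi>c]) (use nk \<phi>_neg in auto)
    have ne: "std_sphere n \<noteq> {}" using in_topspace_nsphere[of n] by auto
    then show "\<phi> ` std_sphere n \<noteq> {}" by simp
    from ne obtain a where "a \<in> std_sphere n" by blast
    then have "signless_energy E (unscale_degree E (z a)) \<le> 2 - l m" by (rule energy)
    moreover have "0 \<le> signless_energy E (unscale_degree E (z a))"
      by (simp add: signless_energy_def sum_nonneg)
    ultimately show "l (CARD('v) - k) \<le> 2" by (simp add: m_def)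
    fix y assume "y \<in> \<phi> ` std_sphere n"
    then obtain a where a: "a \<in> std_sphere n" "y = \<phi> a" by blast
    have "I_plus E y \<le> sqrt (signless_energy E (unscale_degree E (z a))) * sqrt (2 * (z a \<bullet> z a))"
      using I_plus_le_energy[OF E, of "unscale_degree E (z a)"]
      by (simp add: a \<phi>_def signed_square_def scale_unscale[OF iso] flip: norm_scale)
    also have "\<dots> \<le> sqrt (2 - l m) * sqrt 2"
      using energy[OF a(1)] zz[OF a(1)] by (simp add: mult_right_mono)
    finally show "I_plus E y \<le> sqrt (2 - l (CARD('v) - k)) * sqrt 2" by (simp add: m_def)
  qed
qed

lemma continuous_on_I_plus: "continuous_on S (I_plus E)"
  unfolding I_plus_def by (intro continuous_intros)

lemma bdd_above_I_plus: "compact S \<Longrightarrow> bdd_above (I_plus E ` S)"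
  by (intro bounded_imp_bdd_above compact_imp_bounded compact_continuous_image continuous_on_I_plus)

text \<open>Genus at least \<open>k\<close> forces a common zero of the \<open>k - 1\<close>
  coefficients belonging to the top eigenvectors. At that point the Rayleigh quotient is at most
  \<open>l (CARD('v) - k)\<close>, so the energy is large.\<close>

lemma I_plus_ge_of_genus:
  fixes E :: "'v::finite set set" and u :: "nat \<Rightarrow> real ^ 'v"
  assumes E: "simple_graph E" and iso: "no_isolated_vertices E"
    and k: "1 \<le> k" "k \<le> CARD('v)"
    and eig: "\<And>i. i < CARD('v) \<Longrightarrow> symmetric_laplacian E *v u i = l i *\<^sub>R u i"
    and mono: "\<And>i j. i \<le> j \<Longrightarrow> j < CARD('v) \<Longrightarrow> l i \<le> l j"
    and expand: "\<And>x. (\<Sum>i<CARD('v). (x \<bullet> u i) *\<^sub>R u i) = x"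
    and S: "S \<subseteq> unit_sphere_1 E" "enat k \<le> krasnoselskii_genus S"
  shows "\<exists>y\<in>S. 2 - l (CARD('v) - k) \<le> 2 * I_plus E y"
proof -
  define m where "m = CARD('v) - k"
  \<comment> \<open>For \<open>j < k - 1\<close> the index \<open>m + 1 + j\<close> runs through
    exactly the positions above \<open>m\<close>.\<close>
  define g where "g j y = scale_degree E (signed_sqrt y) \<bullet> u (m + 1 + j)" for j y
  have gc: "continuous_on S (g j)" for j
    unfolding g_def scale_degree_def signed_sqrt_def by (auto intro!: continuous_intros)
  have g_neg: "g j (- y) = - g j y" for j y
    by (simp add: g_def scale_degree_def signed_sqrt_def inner_vec_def real_sqrt_minus sum_negf)
  have "\<exists>y\<in>S. \<forall>j<k - 1. g j y = 0"
  proof (rule ccontr)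
    assume "\<not> ?thesis"
    then have "krasnoselskii_genus S \<le> enat (k - 1)"
      by (intro krasnoselskii_genus_le[of _ _ g] gc g_neg) auto
    with S(2) have "enat k \<le> enat (k - 1)" by (rule order_trans)
    then show False using k by simp
  qed
  then obtain y where y: "y \<in> S" and gy: "\<And>j. j < k - 1 \<Longrightarrow> g j y = 0" by blast
  define z where "z = scale_degree E (signed_sqrt y)"
  have zu: "z \<bullet> u i = 0" if "m < i" "i < CARD('v)" for i
    using gy[of "i - m - 1"] that k by (simp add: g_def z_def m_def)
  have zz: "z \<bullet> z = 1"
    using S(1) y by (auto simp: z_def signed_square_sqrt simp flip: in_unit_sphere_1_iff)
  have quad: "x \<bullet> (symmetric_laplacian E *v x) = (\<Sum>i<CARD('v). l i * (x \<bullet> u i)\<^sup>2)"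
    "x \<bullet> x = (\<Sum>i<CARD('v). (x \<bullet> u i)\<^sup>2)" for x
    using eigenbasis_quadratic_form[of "(*v) (symmetric_laplacian E)" "CARD('v)" u l x] eig expand
    by auto
  have "m < CARD('v)" using k by (simp add: m_def)
  have "z \<bullet> (symmetric_laplacian E *v z) \<le> l m * (z \<bullet> z)"
    unfolding quad[of z] sum_distrib_left
  proof (intro sum_mono)
    fix i assume "i \<in> {..<CARD('v)}"
    then show "l i * (z \<bullet> u i)\<^sup>2 \<le> l m * (z \<bullet> u i)\<^sup>2"
      using zu[of i] mono[of i m] \<open>m < CARD('v)\<close> by (cases "m < i") (auto intro!: mult_right_mono)
  qed
  then have "2 - l m \<le> signless_energy E (signed_sqrt y)"
    using zz signless_energy_rayleigh[OF E iso, of z]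
    by (simp add: z_def scale_unscale[OF iso])
  also have "\<dots> \<le> 2 * I_plus E y"
    using energy_le_I_plus[OF E, of "signed_sqrt y"]
    by (simp add: signed_square_sqrt flip: signed_square_def)
  finally show ?thesis using y by (auto simp: m_def)
qed

theorem theorem3p7:
  fixes E :: "'v::finite set set" and k :: nat
  assumes "simple_graph E"
    and "no_isolated_vertices E"
    and "1 \<le> k" and "k \<le> CARD('v)"
  shows "(minmax_eigenvalue E k)\<^sup>2 / 2 \<le> 2 - eigenvalue (normalized_laplacian E) (CARD('v) - k + 1)
       \<and> 2 - eigenvalue (normalized_laplacian E) (CARD('v) - k + 1) \<le> 2 * minmax_eigenvalue E k"
proof -
  note E = assms(1) and iso = assms(2) and k = assms(3,4)
  have "linear ((*v) (symmetric_laplacian E))" by simp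
  from selfadjoint_sorted_eigenbasis[OF this symmetric_laplacian_selfadjoint]
  obtain u :: "nat \<Rightarrow> real ^ 'v" and l where
    eig: "\<And>i. i < CARD('v) \<Longrightarrow> symmetric_laplacian E *v u i = l i *\<^sub>R u i"
    and ortho: "\<And>i j. i < CARD('v) \<Longrightarrow> j < CARD('v) \<Longrightarrow> u i \<bullet> u j = (if i = j then 1 else 0)"
    and mono: "\<And>i j. i \<le> j \<Longrightarrow> j < CARD('v) \<Longrightarrow> l i \<le> l j"
    and expand: "\<And>x. (\<Sum>i<CARD('v). (x \<bullet> u i) *\<^sub>R u i) = x"
    by (auto simp: DIM_cart)
  define c where "c = l (CARD('v) - k)"
  have ev: "eigenvalue (normalized_laplacian E) (CARD('v) - k + 1) = c"
  proof -
    have "eigenvalue (normalized_laplacian E) (Suc (CARD('v) - k)) = l (CARD('v) - k)"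
    \<comment> \<open>The normalized Laplacian need not be symmetric, so its eigenvectors
      \<open>unscale_degree E (u j)\<close> are paired with the dual family
      \<open>scale_degree E (u j)\<close>.\<close>
    proof (rule eigenvalue_diagonalizable[where p = "\<lambda>j. unscale_degree E (u j)"
          and q = "\<lambda>j. scale_degree E (u j)"])
      fix j assume "j < CARD('v)"
      then show "normalized_laplacian E *v unscale_degree E (u j) = l j *\<^sub>R unscale_degree E (u j)"
        by (simp add: normalized_laplacian_unscale[OF iso] eig) (simp add: unscale_degree_def vec_eq_iff)
    qed (use k mono ortho in \<open>auto simp: inner_scale_unscale[OF iso]\<close>)
    then show ?thesis by (simp add: c_def)
  qed
  define \<S> where "\<S> = {S. S \<subseteq> unit_sphere_1 E \<and> compact S \<and> S = uminus ` S \<and> enat k \<le> krasnoselskii_genus S}"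
  have minmax: "minmax_eigenvalue E k = (INF S\<in>\<S>. Sup (I_plus E ` S))"
    unfolding minmax_eigenvalue_def \<S>_def by (rule arg_cong[of _ _ Inf]) auto
  obtain S0 where S0: "S0 \<in> \<S>" "S0 \<noteq> {}" "c \<le> 2"
    and I0: "\<And>y. y \<in> S0 \<Longrightarrow> I_plus E y \<le> sqrt (2 - c) * sqrt 2"
  proof (rule minmax_upper_set[OF E iso k eig ortho mono expand])
    fix S assume "S \<subseteq> unit_sphere_1 E" "compact S" "S = uminus ` S" "enat k \<le> krasnoselskii_genus S"
      "\<And>y. y \<in> S \<Longrightarrow> I_plus E y \<le> sqrt (2 - l (CARD('v) - k)) * sqrt 2"
      "S \<noteq> {}" "l (CARD('v) - k) \<le> 2"
    then show thesis by (intro that[of S]) (simp_all add: c_def \<S>_def)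
  qed
  have lower: "(2 - c) / 2 \<le> Sup (I_plus E ` S)" if S: "S \<in> \<S>" for S
  proof -
    have SD: "S \<subseteq> unit_sphere_1 E" "compact S" "enat k \<le> krasnoselskii_genus S"
      using S unfolding \<S>_def mem_Collect_eq by blast+
    obtain y where y: "y \<in> S" "2 - c \<le> 2 * I_plus E y"
      using I_plus_ge_of_genus[OF E iso k eig mono expand SD(1,3)] unfolding c_def by auto
    moreover have "I_plus E y \<le> Sup (I_plus E ` S)"
    proof (rule cSup_upper)
      show "bdd_above (I_plus E ` S)"
        using SD(2) by (rule bdd_above_I_plus)
    qed (use y in simp)
    ultimately show ?thesis by simp
  qed
  have "(2 - c) / 2 \<le> minmax_eigenvalue E k"
    unfolding minmax by (rule cINF_greatest) (use S0 lower in auto)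
  moreover have "minmax_eigenvalue E k \<le> sqrt (2 * (2 - c))"
  proof -
    have "minmax_eigenvalue E k \<le> Sup (I_plus E ` S0)"
      \<comment> \<open>The fact \<open>lower\<close> also supplies the boundedness below required
        for a real infimum.\<close>
      unfolding minmax by (rule cINF_lower[OF bdd_belowI2[of _ "(2 - c) / 2"]]) (use S0 lower in auto)
    also have "\<dots> \<le> sqrt (2 - c) * sqrt 2"
      using S0(2) I0 by (intro cSUP_least) auto
    finally show ?thesis by (simp only: real_sqrt_mult mult.commute)
  qed
  \<comment> \<open>Nonnegativity, from \<open>c \<le> 2\<close>, permits squaring the upper
    bound.\<close>
  moreover have "0 \<le> minmax_eigenvalue E k" using calculation(1) S0(3) by simp
  ultimately have "(minmax_eigenvalue E k)\<^sup>2 \<le> 2 * (2 - c)"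
    using S0(3) by (metis diff_ge_0_iff_ge mult_nonneg_nonneg power_mono real_sqrt_pow2 zero_le_numeral)
  then show ?thesis
    using \<open>(2 - c) / 2 \<le> minmax_eigenvalue E k\<close> unfolding ev by simp
qed

end
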